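(* Let $A$ be an $m\times m$ real matrix with singular value decomposition $A=U\Sigma V^T$, let $1\le n\le m-1$, and assume $\sigma_n>\sigma_{n+1}>\sigma_{n+2}\ge0$. Let $\mathbb{X}_n=\mathrm{span}\{\mathbf{x}_1,\ldots,\mathbf{x}_n\}$ with $\mathbf{x}_1,\ldots,\mathbf{x}_n$ orthonormal in $\mathbb{R}^m$, and write $\mathbf{x}_j=\sum_{i=1}^m w_{ij}\mathbf{u}_i$, $j=1,\ldots,n$. For $\mathcal{J}\subseteq\{1,\ldots,n,n+2,\ldots,m\}$ let $M_{\mathcal{J}}=[m_{ij}]_{i,j=1,\ldots,n}$ be the $n\times n$ matrix with elements $$m_{ij}=\sigma_{n+1}^2\sum_{k\in\mathcal{J}}\frac{w_{ki}w_{kj}}{\sigma_{n+1}^2-\sigma_k^2}+\sum_{k\in\{1,\ldots,m\}\setminus\mathcal{J}}w_{ki}w_{kj}.$$ Then the subspace $\mathbb{X}_n$ is optimal for $\mathcal{A}$ if and only if $\mathbb{X}_n\perp\mathbf{u}_{n+1}$ and for all sets of indices $\mathcal{J}\subseteq\{1,\ldots,n,n+2,\ldots,m\}$ such that $\{1,\ldots,n\}\cap\mathcal{J}\ne\emptyset$ we have $$(-1)^s\det(M_{\mathcal{J}})\ge0,$$ where $s$ is the cardinality of $\{1,\ldots,n\}\cap\mathcal{J}$.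
   Context: $\|\cdot\|$ is the Euclidean norm. $A=U\Sigma V^T$ is any singular value decomposition: $U,V$ are orthogonal with $j$-th columns $\mathbf{u}_j,\mathbf{v}_j$, and $\Sigma$ is diagonal with diagonal entries $\sigma_1\ge\cdots\ge\sigma_m\ge0$; by convention $\sigma_{m+1}:=0$. Set $\mathcal{A}:=\{A\mathbf{x}:\mathbf{x}\in\mathbb{R}^m,\ \|\mathbf{x}\|\le1\}$. For a subspace $\mathbb{X}$ of $\mathbb{R}^m$, $E(\mathcal{A},\mathbb{X}):=\max_{\mathbf{a}\in\mathcal{A}}\min_{\mathbf{x}\in\mathbb{X}}\|\mathbf{a}-\mathbf{x}\|$, and $d_n(\mathcal{A}):=\min_{\mathbb{X}_n}E(\mathcal{A},\mathbb{X}_n)$ over all $n$-dimensional subspaces $\mathbb{X}_n$ of $\mathbb{R}^m$. An $n$-dimensional subspace $\mathbb{X}_n$ is optimal for $\mathcal{A}$ if $E(\mathcal{A},\mathbb{X}_n)=d_n(\mathcal{A})$. $\mathbb{X}_n\perp\mathbf{u}_{n+1}$ means every vector of $\mathbb{X}_n$ is orthogonal to $\mathbf{u}_{n+1}$. *)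

theory Defs
  imports "HOL-Analysis.Analysis" "Jordan_Normal_Form.Determinant"
begin

(* Both matrix libraries use the infix $; here it always means a component of a vector in R^m.
   Square matrices of size m = CARD('m) and the geometry of R^m are those of HOL-Analysis; the
   small matrix indexed by natural numbers 1..n is a Jordan_Normal_Form matrix. *)
no_notation Matrix.vec_index (infixl "$" 100)

(* The rows and columns of real^'m^'m carry no order, so an ordered singular value decomposition
   needs a numbering e of the index type by 1, ..., m. *)
definition is_svd ::
  "(nat \<Rightarrow> 'm::finite) \<Rightarrow> real^'m^'m \<Rightarrow> real^'m^'m \<Rightarrow> real^'m^'m \<Rightarrow> real^'m^'m \<Rightarrow> bool" where
  "is_svd e A U S V \<longleftrightarrow>
     bij_betw e {1..CARD('m)} UNIV \<and>
     orthogonal_matrix U \<and> orthogonal_matrix V \<and>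
     (\<forall>i j. i \<noteq> j \<longrightarrow> S $ i $ j = 0) \<and>
     (\<forall>k\<in>{1..CARD('m)}. 0 \<le> S $ e k $ e k) \<and>
     (\<forall>k\<in>{1..<CARD('m)}. S $ e (Suc k) $ e (Suc k) \<le> S $ e k $ e k) \<and>
     A = U ** S ** Finite_Cartesian_Product.transpose V"

(* In particular the value at m + 1 is 0. *)
definition sing_val :: "(nat \<Rightarrow> 'm::finite) \<Rightarrow> real^'m^'m \<Rightarrow> nat \<Rightarrow> real" where
  "sing_val e S k = (if k \<in> {1..CARD('m)} then S $ e k $ e k else 0)"

definition left_sing_vec :: "(nat \<Rightarrow> 'm::finite) \<Rightarrow> real^'m^'m \<Rightarrow> nat \<Rightarrow> real^'m" where
  "left_sing_vec e U k = column (e k) U"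

definition ball_image :: "real^'m^'m \<Rightarrow> (real^'m::finite) set" where
  "ball_image A = {A *v x | x. norm x \<le> 1}"

(* For the sets of interest (compact, nonempty) the supremum and the infimum are attained,
   see approx_error_min and approx_error_max below. *)
definition approx_error :: "'a::euclidean_space set \<Rightarrow> 'a set \<Rightarrow> real" where
  "approx_error K X = (SUP a\<in>K. INF x\<in>X. norm (a - x))"

definition n_width :: "nat \<Rightarrow> 'a::euclidean_space set \<Rightarrow> real" where
  "n_width n K = (INF X\<in>{X. subspace X \<and> dim X = n}. approx_error K X)"

definition optimal_subspace :: "nat \<Rightarrow> 'a::euclidean_space set \<Rightarrow> 'a set \<Rightarrow> bool" where
  "optimal_subspace n K X \<longleftrightarrow>
     subspace X \<and> dim X = n \<and> approx_error K X = n_width n K"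

(* Jordan_Normal_Form matrices are indexed from 0, hence the shift of i and j. *)
definition M_mat ::
  "nat \<Rightarrow> nat \<Rightarrow> (nat \<Rightarrow> real) \<Rightarrow> (nat \<Rightarrow> nat \<Rightarrow> real) \<Rightarrow> nat set \<Rightarrow> real Matrix.mat" where
  "M_mat m n \<sigma> w J = Matrix.mat n n (\<lambda>(i, j).
     (\<sigma> (n + 1))\<^sup>2 *
       (\<Sum>k\<in>J. w k (i + 1) * w k (j + 1) / ((\<sigma> (n + 1))\<^sup>2 - (\<sigma> k)\<^sup>2)) +
     (\<Sum>k\<in>{1..m} - J. w k (i + 1) * w k (j + 1)))"

lemma compact_ball_image: "compact (ball_image A)"
proof -
  have "ball_image A = (\<lambda>x. A *v x) ` cball 0 1"
    by (auto simp: ball_image_def image_def)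
  thus ?thesis
    by (simp add: compact_continuous_image linear_continuous_on linear_linear)
qed

lemma ball_image_nonempty: "ball_image A \<noteq> {}"
proof -
  have "A *v 0 \<in> ball_image A"
    unfolding ball_image_def by (rule CollectI, rule exI[of _ 0]) simp
  thus ?thesis by blast
qed

lemma approx_error_min:
  fixes X :: "'a::euclidean_space set"
  assumes "subspace X"
  shows "\<exists>x\<in>X. norm (a - x) = (INF x\<in>X. norm (a - x)) \<and> (\<forall>y\<in>X. norm (a - x) \<le> norm (a - y))"
proof -
  have ne: "X \<noteq> {}" using subspace_0[OF assms] by blast
  obtain x where x: "x \<in> X" "infdist a X = dist a x"
    using infdist_attains_inf[OF closed_subspace[OF assms] ne] by metis
  have "(INF x\<in>X. norm (a - x)) = infdist a X"
    using ne by (simp add: infdist_notempty dist_norm)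
  thus ?thesis using x by (metis dist_norm infdist_le)
qed

lemma approx_error_max:
  fixes X :: "'a::euclidean_space set"
  assumes "compact K" "K \<noteq> {}" "subspace X"
  shows "\<exists>a\<in>K. approx_error K X = (INF x\<in>X. norm (a - x)) \<and>
           (\<forall>b\<in>K. (INF x\<in>X. norm (b - x)) \<le> (INF x\<in>X. norm (a - x)))"
proof -
  have ne: "X \<noteq> {}" using subspace_0[OF assms(3)] by blast
  have eq: "(INF x\<in>X. norm (b - x)) = infdist b X" for b
    using ne by (simp add: infdist_notempty dist_norm)
  have "continuous_on K (\<lambda>b. infdist b X)"
    by (intro continuous_intros)
  then obtain a where a: "a \<in> K" "\<And>b. b \<in> K \<Longrightarrow> infdist b X \<le> infdist a X"
    using continuous_attains_sup[OF assms(1,2)] by metis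
  have "(SUP b\<in>K. infdist b X) = infdist a X"
    using a by (intro cSup_eq_maximum) auto
  thus ?thesis using a unfolding approx_error_def eq by blast
qed

end

theory Submission
  imports Defs
begin

text \<open>
  Write \<open>s = \<sigma> (n + 1)\<close>, which is the \<open>n\<close>-width. In the coordinates given by the columns of \<open>V\<close> and \<open>U\<close>
  the subspace is optimal iff the quadratic form of \<open>D + \<Sigma> W W\<^sup>T \<Sigma>\<close> with
  \<open>D = diag (s\<^sup>2 - \<sigma>\<^sub>k\<^sup>2)\<close> is nonnegative. A nonzero vector supported on the first \<open>n + 1\<close> coordinates
  and killed by the \<open>n\<close> rows of \<open>W\<^sup>T \<Sigma>\<close> shows that then row \<open>n + 1\<close> of \<open>W\<close> vanishes. A symmetric
  matrix is positive semidefinite iff all its principal minors are nonnegative, and by Sylvester's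
  identity \<open>det (1 + X Y) = det (1 + Y X)\<close> together with \<open>W\<^sup>T W = 1\<close> the principal minor on \<open>J\<close> is
  \<open>(\<Prod>k\<in>J. s\<^sup>2 - \<sigma>\<^sub>k\<^sup>2) det M\<^sub>J\<close>, whose first factor has sign \<open>(-1) ^ card ({1..n} \<inter> J)\<close>.
  The minors with \<open>J\<close> disjoint from \<open>{1..n}\<close> are nonnegative anyway.
\<close>

subsection \<open>Determinants\<close>

text \<open>Kernel vectors appear as plain functions on \<open>nat\<close>, so that singularity
  combines directly with the finite sums in \<open>quad_form\<close>.\<close>

lemma det_mat_eq_0_iff:
  fixes F :: "nat \<Rightarrow> nat \<Rightarrow> real"
  shows "Determinant.det (Matrix.mat m m (\<lambda>(i, j). F i j)) = 0 \<longleftrightarrow>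
    (\<exists>z. (\<exists>i<m. z i \<noteq> 0) \<and> (\<forall>i<m. (\<Sum>j<m. F i j * z j) = 0))" (is "?L = ?R")
proof -
  let ?M = "Matrix.mat m m (\<lambda>(i, j). F i j)"
  have M: "?M \<in> carrier_mat m m" by simp
  have prod: "?M *\<^sub>v v = 0\<^sub>v m \<longleftrightarrow> (\<forall>i<m. (\<Sum>j<m. F i j * vec_index v j) = 0)"
    if "v \<in> carrier_vec m" for v
    using that by (auto simp: vec_eq_iff scalar_prod_def lessThan_atLeast0)
  show ?thesis unfolding det_0_iff_vec_prod_zero[OF M]
  proof
    assume "\<exists>v. v \<in> carrier_vec m \<and> v \<noteq> 0\<^sub>v m \<and> ?M *\<^sub>v v = 0\<^sub>v m"
    then obtain v where v: "v \<in> carrier_vec m" "v \<noteq> 0\<^sub>v m" "?M *\<^sub>v v = 0\<^sub>v m" by blast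
    have "\<exists>i<m. vec_index v i \<noteq> 0" using v(1,2) by (auto simp: Matrix.vec_eq_iff)
    thus ?R using prod[OF v(1)] v(3) by (intro exI[of _ "vec_index v"]) auto
  next
    assume ?R
    then obtain z where z: "\<exists>i<m. z i \<noteq> 0" "\<forall>i<m. (\<Sum>j<m. F i j * z j) = 0" by blast
    have "Matrix.vec m z \<in> carrier_vec m" "Matrix.vec m z \<noteq> 0\<^sub>v m"
      using z(1) by (auto simp: Matrix.vec_eq_iff)
    moreover have "?M *\<^sub>v Matrix.vec m z = 0\<^sub>v m"
      using z(2) by (subst prod) auto
    ultimately show "\<exists>v. v \<in> carrier_vec m \<and> v \<noteq> 0\<^sub>v m \<and> ?M *\<^sub>v v = 0\<^sub>v m" by blast
  qed
qed

text \<open>Each summand of the Leibniz formula contains exactly one factor from row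
  \<open>k\<close>, so the determinant is linear in that row.\<close>

lemma det_mat_row_add:
  fixes F :: "nat \<Rightarrow> nat \<Rightarrow> real"
  assumes "k < m"
  shows "Determinant.det (Matrix.mat m m (\<lambda>(i, j). if i = k then a j + t * b j else F i j)) =
    Determinant.det (Matrix.mat m m (\<lambda>(i, j). if i = k then a j else F i j)) +
    t * Determinant.det (Matrix.mat m m (\<lambda>(i, j). if i = k then b j else F i j))"
proof -
  have expand: "Determinant.det (Matrix.mat m m (\<lambda>(i, j). if i = k then c j else F i j)) =
    (\<Sum>p\<in>{p. p permutes {0..<m}}. signof p * (c (p k) * (\<Prod>i\<in>{0..<m} - {k}. F i (p i))))"
    for c
  proof -
    have "(\<Prod>i = 0..<m. Matrix.mat m m (\<lambda>(i, j). if i = k then c j else F i j) $$ (i, p i)) =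
        c (p k) * (\<Prod>i\<in>{0..<m} - {k}. F i (p i))" if p: "p permutes {0..<m}" for p
    proof -
      have "(\<Prod>i = 0..<m. Matrix.mat m m (\<lambda>(i, j). if i = k then c j else F i j) $$ (i, p i)) =
          (\<Prod>i = 0..<m. if i = k then c (p i) else F i (p i))"
        using permutes_in_image[OF p] by (intro prod.cong) auto
      also have "\<dots> = c (p k) * (\<Prod>i\<in>{0..<m} - {k}. if i = k then c (p i) else F i (p i))"
        using assms by (subst prod.remove[of _ k]) auto
      also have "(\<Prod>i\<in>{0..<m} - {k}. if i = k then c (p i) else F i (p i)) =
          (\<Prod>i\<in>{0..<m} - {k}. F i (p i))"
        by (intro prod.cong) auto
      finally show ?thesis .
    qed
    thus ?thesis by (subst det_def'[of _ m]) (auto intro!: sum.cong)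
  qed
  show ?thesis
    unfolding expand by (simp add: algebra_simps sum.distrib sum_distrib_left)
qed

text \<open>The block matrices \<open>?M\<close> and \<open>?T\<close> multiply to a block lower
  triangular matrix in either order, with diagonal blocks \<open>1, 1 + Y X\<close> for one order
  and \<open>1 + X Y, 1\<close> for the other. The determinant of the product does not depend on the
  order.\<close>

lemma det_one_plus_mult_commute:
  fixes X Y :: "'a::idom Matrix.mat"
  assumes X: "X \<in> carrier_mat m n" and Y: "Y \<in> carrier_mat n m"
  shows "Determinant.det (1\<^sub>m m + X * Y) = Determinant.det (1\<^sub>m n + Y * X)"
proof -
  let ?M = "four_block_mat (1\<^sub>m m) (- X) Y (1\<^sub>m n)"
  let ?T = "four_block_mat (1\<^sub>m m) X (0\<^sub>m n m) (1\<^sub>m n)"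
  have M: "?M \<in> carrier_mat (m + n) (m + n)" and T: "?T \<in> carrier_mat (m + n) (m + n)"
    using assms by auto
  have XY: "X * Y \<in> carrier_mat m m" and YX: "Y * X \<in> carrier_mat n n" using assms by auto
  have "?M * ?T = four_block_mat (1\<^sub>m m) (0\<^sub>m m n) Y (1\<^sub>m n + Y * X)"
    using assms XY YX
    by (subst mult_four_block_mat[where ?nr1.0 = m and ?n1.0 = m and ?n2.0 = n
          and ?nr2.0 = n and ?nc1.0 = m and ?nc2.0 = n])
       (auto intro!: cong_four_block_mat)
  hence 1: "Determinant.det ?M * Determinant.det ?T = Determinant.det (1\<^sub>m n + Y * X)"
    using det_four_block_mat_upper_right_zero[of "1\<^sub>m m" m "0\<^sub>m m n" n Y "1\<^sub>m n + Y * X"]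
      det_mult[OF M T] assms YX by simp
  have "?T * ?M = four_block_mat (1\<^sub>m m + X * Y) (0\<^sub>m m n) Y (1\<^sub>m n)"
    using assms XY YX
    by (subst mult_four_block_mat[where ?nr1.0 = m and ?n1.0 = m and ?n2.0 = n
          and ?nr2.0 = n and ?nc1.0 = m and ?nc2.0 = n])
       (auto intro!: cong_four_block_mat)
  hence 2: "Determinant.det ?T * Determinant.det ?M = Determinant.det (1\<^sub>m m + X * Y)"
    using det_four_block_mat_upper_right_zero[of "1\<^sub>m m + X * Y" m "0\<^sub>m m n" n Y "1\<^sub>m n"]
      det_mult[OF T M] assms XY by simp
  show ?thesis using 1 2 by (simp add: mult.commute)
qed

subsection \<open>Positive semidefinite matrices and principal minors\<close>

text \<open>
  Only the rows outside \<open>J\<close> are replaced by unit vectors; the determinant is still the principal minor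
  on \<open>J\<close>, and being a change of rows alone makes row multilinearity directly applicable.
\<close>

definition principal_mat :: "nat \<Rightarrow> (nat \<Rightarrow> nat \<Rightarrow> real) \<Rightarrow> nat set \<Rightarrow> real Matrix.mat" where
  "principal_mat m B J =
     Matrix.mat m m (\<lambda>(i, j). if i \<in> J then B i j else if i = j then 1 else 0)"

definition quad_form :: "nat \<Rightarrow> (nat \<Rightarrow> nat \<Rightarrow> real) \<Rightarrow> (nat \<Rightarrow> real) \<Rightarrow> real" where
  "quad_form m B z = (\<Sum>i<m. \<Sum>j<m. z i * B i j * z j)"

text \<open>
  Along the segment from the identity to the matrix the determinant does not vanish before the end
  point, because a kernel vector is supported on \<open>J\<close> and the form is positive there.
\<close>

lemma principal_minor_nonneg:
  assumes psd: "\<And>z. (\<And>i. i < m \<Longrightarrow> i \<notin> J \<Longrightarrow> z i = 0) \<Longrightarrow> 0 \<le> quad_form m B z"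
  shows "0 \<le> Determinant.det (principal_mat m B J)"
proof (rule ccontr)
  define G where "G s i j = (if i \<in> J then s * B i j + (1 - s) * (if i = j then 1 else 0)
    else if i = j then 1 else 0)" for s :: real and i j
  define f where "f s = Determinant.det (Matrix.mat m m (\<lambda>(i, j). G s i j))" for s
  assume "\<not> 0 \<le> Determinant.det (principal_mat m B J)"
  moreover have "Determinant.det (principal_mat m B J) = f 1"
    unfolding f_def principal_mat_def G_def by (intro arg_cong[of _ _ Determinant.det]) auto
  ultimately have f1: "f 1 < 0" by simp
  have "Matrix.mat m m (\<lambda>(i, j). G 0 i j) = 1\<^sub>m m"
    by (auto simp: G_def)
  hence f0: "f 0 = 1" unfolding f_def by simp
  have f_eq: "f s = (\<Sum>p\<in>{p. p permutes {0..<m}}. signof p * (\<Prod>i = 0..<m. G s i (p i)))" for s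
    unfolding f_def by (subst det_def'[of _ m]) (auto intro!: sum.cong prod.cong)
  have "continuous_on {0..1} (\<lambda>s. G s i j)" for i j
    unfolding G_def by (cases "i \<in> J") (auto intro!: continuous_intros)
  hence "continuous_on {0..1} f" unfolding f_eq
    by (intro continuous_on_sum continuous_on_mult continuous_on_prod continuous_on_const)
  then obtain s where s: "0 \<le> s" "s \<le> 1" "f s = 0"
    using IVT2'[of f 1 0 0] f0 f1 by auto
  have "s < 1" using s f1 by (cases "s = 1") auto
  obtain z where z: "\<exists>i<m. z i \<noteq> 0" and Gz: "\<And>i. i < m \<Longrightarrow> (\<Sum>j<m. G s i j * z j) = 0"
    using s(3) unfolding f_def det_mat_eq_0_iff by blast
  have delta: "(\<Sum>j<m. (if i = j then 1 else 0) * z j) = z i" if "i < m" for i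
    using that by (simp add: if_distrib[of "\<lambda>t. t * _"] cong: if_cong)
  have out: "z i = 0" if "i < m" "i \<notin> J" for i
    using Gz[OF that(1)] delta[OF that(1)] that by (simp add: G_def)
  \<comment> \<open>Row \<open>i\<close> of \<open>G s\<close> applied to \<open>z\<close>,
    multiplied by \<open>z i\<close>. Outside \<open>J\<close> both terms vanish by
    \<open>out\<close>, so the equations can be summed over all \<open>i\<close> to produce the
    quadratic form.\<close>
  have row: "s * (z i * (\<Sum>j<m. B i j * z j)) + (1 - s) * (z i)\<^sup>2 = 0" if i: "i < m" for i
  proof (cases "i \<in> J")
    case True
    have "(\<Sum>j<m. G s i j * z j) =
        s * (\<Sum>j<m. B i j * z j) + (1 - s) * (\<Sum>j<m. (if i = j then 1 else 0) * z j)"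
      using True
      by (simp add: G_def sum.distrib[symmetric] sum_distrib_left distrib_right mult.assoc)
    hence "s * (\<Sum>j<m. B i j * z j) + (1 - s) * z i = 0" using Gz[OF i] delta[OF i] by simp
    hence "z i * (s * (\<Sum>j<m. B i j * z j) + (1 - s) * z i) = 0" by simp
    thus ?thesis by (simp add: algebra_simps power2_eq_square)
  qed (use out i in simp)
  have "0 = (\<Sum>i<m. s * (z i * (\<Sum>j<m. B i j * z j)) + (1 - s) * (z i)\<^sup>2)"
    using row by (simp add: sum.neutral)
  also have "\<dots> = s * quad_form m B z + (1 - s) * (\<Sum>i<m. (z i)\<^sup>2)"
    unfolding quad_form_def by (simp add: sum.distrib sum_distrib_left mult.assoc)
  finally have eq: "s * quad_form m B z + (1 - s) * (\<Sum>i<m. (z i)\<^sup>2) = 0" by simp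
  have "0 < (\<Sum>i<m. (z i)\<^sup>2)"
    using z by (auto intro!: sum_pos2)
  hence "0 < (1 - s) * (\<Sum>i<m. (z i)\<^sup>2)" using \<open>s < 1\<close> by simp
  moreover have "0 \<le> s * quad_form m B z" using psd[of z] out s by simp
  ultimately show False using eq by linarith
qed

text \<open>Adding \<open>t\<close> to the diagonal entry \<open>k \<in> J\<close> adds
  \<open>t\<close> times the minor on \<open>J - {k}\<close>, by linearity in row \<open>k\<close>.
  Induction on the set \<open>T\<close> of shifted entries accumulates these nonnegative
  contributions; the bound \<open>0\<close> for the other \<open>J\<close> keeps the induction
  going.\<close>

lemma det_shifted_principal_mat_ge:
  assumes minors: "\<And>J. J \<subseteq> {..<m} \<Longrightarrow> 0 \<le> Determinant.det (principal_mat m B J)"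
    and t: "0 \<le> t" and T: "finite T" "T \<subseteq> {..<m}" and J: "J \<subseteq> {..<m}"
  shows "(if J \<subseteq> T then t ^ card J else 0) \<le> Determinant.det
    (principal_mat m (\<lambda>i j. B i j + (if i = j \<and> i \<in> T then t else 0)) J)"
  using T J
proof (induction T arbitrary: J rule: finite_induct)
  case empty
  have "Determinant.det (principal_mat m B {}) = 1"
  proof -
    have "principal_mat m B {} = 1\<^sub>m m" unfolding principal_mat_def by auto
    thus ?thesis by simp
  qed
  moreover have "principal_mat m (\<lambda>i j. B i j + (if i = j \<and> i \<in> {} then t else 0)) J =
      principal_mat m B J" by simp
  ultimately show ?case using minors[OF empty(2)] by auto
next
  case (insert k T)
  let ?C = "\<lambda>T i j. B i j + (if i = j \<and> i \<in> T then t else 0)"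
  have sub: "T \<subseteq> {..<m}" "k < m" using insert by auto
  show ?case
  proof (cases "k \<in> J")
    case False
    have "principal_mat m (?C (insert k T)) J = principal_mat m (?C T) J"
      using False unfolding principal_mat_def by (intro cong_mat) auto
    thus ?thesis using insert.IH[OF sub(1) insert.prems(2)] False by (auto simp: subset_insert)
  next
    case True
    let ?F = "\<lambda>i j. if i \<in> J then ?C T i j else if i = j then 1 else 0"
    have 1: "principal_mat m (?C (insert k T)) J =
        Matrix.mat m m (\<lambda>(i, j). if i = k then ?C T k j + t * (if k = j then 1 else 0) else ?F i j)"
      using True insert.hyps unfolding principal_mat_def by (intro cong_mat) auto
    have 2: "principal_mat m (?C T) J =
        Matrix.mat m m (\<lambda>(i, j). if i = k then ?C T k j else ?F i j)"
      using True unfolding principal_mat_def by (intro cong_mat) auto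
    \<comment> \<open>With a unit vector in row \<open>k\<close>, this index drops out of the
      principal minor.\<close>
    have 3: "principal_mat m (?C T) (J - {k}) =
        Matrix.mat m m (\<lambda>(i, j). if i = k then if k = j then 1 else 0 else ?F i j)"
      unfolding principal_mat_def by (intro cong_mat) auto
    have eq: "Determinant.det (principal_mat m (?C (insert k T)) J) =
        Determinant.det (principal_mat m (?C T) J) +
        t * Determinant.det (principal_mat m (?C T) (J - {k}))"
      unfolding 1 2 3 by (rule det_mat_row_add[OF sub(2)])
    have IH1: "0 \<le> Determinant.det (principal_mat m (?C T) J)"
      using insert.IH[OF sub(1) insert.prems(2)] t by (auto split: if_splits intro: order_trans[rotated])
    have IH2: "(if J - {k} \<subseteq> T then t ^ card (J - {k}) else 0) \<le>
        Determinant.det (principal_mat m (?C T) (J - {k}))"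
      using insert.IH[OF sub(1), of "J - {k}"] insert.prems(2) by blast
    have "finite J" using insert.prems(2) finite_subset by blast
    hence card: "card J = Suc (card (J - {k}))" using True by (metis card_Suc_Diff1)
    have "(if J \<subseteq> insert k T then t ^ card J else 0) =
        t * (if J - {k} \<subseteq> T then t ^ card (J - {k}) else 0)"
      unfolding card by auto
    also have "\<dots> \<le> t * Determinant.det (principal_mat m (?C T) (J - {k}))"
      using IH2 t by (rule mult_left_mono)
    finally show ?thesis using eq IH1 by linarith
  qed
qed

text \<open>A minimizer on the unit sphere exists by compactness, and homogeneity of degree two
  extends the bound to all vectors. The sphere lies in a function space, so the coordinates from
  \<open>m\<close> on are fixed at \<open>undefined\<close>.\<close>

lemma quad_form_attains_min:
  assumes "0 < m"
  obtains z where "(\<Sum>i<m. (z i)\<^sup>2) = 1"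
    and "\<And>y. quad_form m B z * (\<Sum>i<m. (y i)\<^sup>2) \<le> quad_form m B y"
proof -
  let ?K = "PiE {..<m} (\<lambda>_. {-1..1::real})"
  let ?S = "?K \<inter> {z. (\<Sum>i<m. (z i)\<^sup>2) = 1}"
  have coord: "continuous_on T (\<lambda>z::nat \<Rightarrow> real. z i)" for T i
    by (rule continuous_on_subset[OF continuous_on_product_coordinates subset_UNIV])
  \<comment> \<open>As a product over all of \<open>nat\<close>, the box has interval factors below
    \<open>m\<close> and one-point factors from \<open>m\<close> on, all of them compact.\<close>
  have "compactin (product_topology (\<lambda>_. euclidean) UNIV)
      (PiE UNIV (\<lambda>i. if i < m then {-1..1::real} else {undefined}))"
    unfolding compactin_PiE by auto
  also have "PiE UNIV (\<lambda>i. if i < m then {-1..1::real} else {undefined}) = ?K"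
    by (auto simp: PiE_def Pi_def extensional_def split: if_splits)
  finally have "compact ?K" by (simp add: euclidean_product_topology)
  moreover have "closed {z::nat \<Rightarrow> real. (\<Sum>i<m. (z i)\<^sup>2) = 1}"
    by (intro closed_Collect_eq continuous_on_sum continuous_on_power continuous_on_const coord)
  ultimately have "compact ?S" by blast
  moreover have "(\<lambda>i. if i < m then if i = 0 then 1 else 0 else undefined) \<in> ?S"
    using assms by (auto simp: if_distrib[of "\<lambda>t. t\<^sup>2"] cong: if_cong split: if_splits)
  hence "?S \<noteq> {}" by blast
  moreover have "continuous_on ?S (quad_form m B)"
    unfolding quad_form_def
    by (intro continuous_on_sum continuous_on_mult continuous_on_const coord)
  ultimately obtain z where z: "z \<in> ?S" and min: "\<And>y. y \<in> ?S \<Longrightarrow> quad_form m B z \<le> quad_form m B y"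
    using continuous_attains_inf[of ?S "quad_form m B"] by metis
  show thesis
  proof (rule that)
    show "(\<Sum>i<m. (z i)\<^sup>2) = 1" using z by simp
    fix y :: "nat \<Rightarrow> real"
    define q where "q = (\<Sum>i<m. (y i)\<^sup>2)"
    show "quad_form m B z * (\<Sum>i<m. (y i)\<^sup>2) \<le> quad_form m B y"
    proof (cases "q = 0")
      case True
      hence "y i = 0" if "i < m" for i
        using that by (auto simp: q_def sum_nonneg_eq_0_iff)
      thus ?thesis by (simp add: quad_form_def)
    next
      case False
      hence q: "0 < q" unfolding q_def by (simp add: sum_nonneg less_le)
      \<comment> \<open>Scaling to unit length; the restriction gives the coordinates from
        \<open>m\<close> on the value \<open>undefined\<close> that \<open>?K\<close>
        requires.\<close>
      define x where "x = restrict (\<lambda>i. y i / sqrt q) {..<m}"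
      have "(y i)\<^sup>2 \<le> q" if "i < m" for i
        unfolding q_def by (rule member_le_sum) (use that in auto)
      hence "\<bar>y i\<bar> \<le> sqrt q" if "i < m" for i
        using that real_sqrt_le_mono[of "(y i)\<^sup>2" q] by simp
      hence "\<bar>y i / sqrt q\<bar> \<le> 1" if "i < m" for i using that q by simp
      hence "x \<in> ?K" unfolding x_def
        by (auto simp: abs_le_iff minus_le_iff simp del: abs_divide)
      moreover have "(\<Sum>i<m. (x i)\<^sup>2) = (\<Sum>i<m. (y i)\<^sup>2) / q"
        using q by (simp add: x_def power_divide sum_divide_distrib)
      hence "(\<Sum>i<m. (x i)\<^sup>2) = 1" using q by (simp add: q_def)
      ultimately have "quad_form m B z \<le> quad_form m B x" using min by blast
      also have "quad_form m B x = quad_form m B y / q"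
        using q by (simp add: quad_form_def x_def sum_divide_distrib)
      finally show ?thesis using q by (simp add: field_simps q_def)
    qed
  qed
qed

text \<open>A zero \<open>z\<close> of a nonnegative form is a minimizer, so its first variation
  vanishes: along \<open>z + t * d\<close> the form is \<open>2 * t * r + t\<^sup>2 * C i i\<close>,
  which would be negative for a small \<open>t\<close> of sign opposite to \<open>r\<close>.\<close>

lemma quad_form_null_vector:
  assumes sym: "\<And>i j. i < m \<Longrightarrow> j < m \<Longrightarrow> C i j = C j i"
    and psd: "\<And>y. 0 \<le> quad_form m C y" and null: "quad_form m C z = 0" and i: "i < m"
  shows "(\<Sum>j<m. C i j * z j) = 0"
proof (rule ccontr)
  define r where "r = (\<Sum>j<m. C i j * z j)"
  assume "(\<Sum>j<m. C i j * z j) \<noteq> 0"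
  hence r: "r \<noteq> 0" by (simp add: r_def)
  define d :: "nat \<Rightarrow> real" where "d j = (if j = i then 1 else 0)" for j
  have delta: "(\<Sum>a<m. d a * f a) = f i" for f
    using i by (simp add: d_def if_distrib[of "\<lambda>t. t * _"] cong: if_cong)
  have quad: "quad_form m C (\<lambda>j. z j + t * d j) = 2 * t * r + t\<^sup>2 * C i i" for t
  proof -
    have "(z a + t * d a) * C a b * (z b + t * d b) = z a * C a b * z b
        + t * (d a * (C a b * z b)) + t * (d b * (z a * C a b)) + t\<^sup>2 * (d a * (d b * C a b))"
      for a b by (simp add: algebra_simps power2_eq_square)
    hence "quad_form m C (\<lambda>j. z j + t * d j) = quad_form m C z
        + t * (\<Sum>a<m. d a * (\<Sum>b<m. C a b * z b))
        + t * (\<Sum>a<m. \<Sum>b<m. d b * (z a * C a b))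
        + t\<^sup>2 * (\<Sum>a<m. d a * (\<Sum>b<m. d b * C a b))"
      unfolding quad_form_def by (simp only: sum.distrib sum_distrib_left)
    \<comment> \<open>This cross term is a sum down column \<open>i\<close>; symmetry turns it into
      the row sum \<open>r\<close>.\<close>
    also have "(\<Sum>a<m. \<Sum>b<m. d b * (z a * C a b)) = (\<Sum>a<m. C i a * z a)"
      unfolding delta using sym i by (intro sum.cong) auto
    finally show ?thesis unfolding delta null r_def by simp
  qed
  \<comment> \<open>For \<open>t = - r / c\<close> the form is
    \<open>r\<^sup>2 / c * (C i i / c - 2)\<close>, negative because \<open>0 < c\<close> and
    \<open>C i i < c\<close>.\<close>
  define c where "c = \<bar>C i i\<bar> + 1"
  have c: "c > 0" "C i i < c" by (auto simp: c_def)
  have "0 \<le> 2 * (- r / c) * r + (- r / c)\<^sup>2 * C i i"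
    using psd[of "\<lambda>j. z j + (- r / c) * d j"] unfolding quad .
  also have "\<dots> = r\<^sup>2 / c * (C i i / c - 2)"
    using c by (simp add: field_simps power2_eq_square)
  also have "\<dots> < 0"
    using c r by (intro mult_pos_neg) (auto simp: field_simps)
  finally show False by simp
qed

text \<open>
  If the minimum \<open>-t\<close> of the form on the unit sphere were negative, the matrix shifted by \<open>t\<close> would be
  singular, while its determinant is at least \<open>t ^ m\<close>.
\<close>

lemma quad_form_nonneg_if_minors_nonneg:
  assumes sym: "\<And>i j. i < m \<Longrightarrow> j < m \<Longrightarrow> B i j = B j i"
    and minors: "\<And>J. J \<subseteq> {..<m} \<Longrightarrow> 0 \<le> Determinant.det (principal_mat m B J)"
  shows "0 \<le> quad_form m B y"
proof (cases "m = 0")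
  case False
  then obtain z where z: "(\<Sum>i<m. (z i)\<^sup>2) = 1"
    and min: "\<And>y. quad_form m B z * (\<Sum>i<m. (y i)\<^sup>2) \<le> quad_form m B y"
    using quad_form_attains_min[of m B] by auto
  have "0 \<le> quad_form m B z"
  proof (rule ccontr)
    define t where "t = - quad_form m B z"
    assume "\<not> 0 \<le> quad_form m B z"
    hence t: "0 < t" by (simp add: t_def)
    define C where "C = (\<lambda>i j. B i j + (if i = j \<and> i \<in> {..<m} then t else 0))"
    have C: "quad_form m C y = quad_form m B y + t * (\<Sum>i<m. (y i)\<^sup>2)" for y
    proof -
      have "(\<Sum>j<m. y i * (if i = j \<and> i \<in> {..<m} then t else 0) * y j) = t * (y i)\<^sup>2" if "i < m" for i
        using that by (simp add: if_distrib if_distribR power2_eq_square cong: if_cong)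
      hence "(\<Sum>i<m. \<Sum>j<m. y i * (if i = j \<and> i \<in> {..<m} then t else 0) * y j) =
          t * (\<Sum>i<m. (y i)\<^sup>2)"
        by (simp add: sum_distrib_left)
      thus ?thesis
        unfolding quad_form_def C_def by (simp only: distrib_left distrib_right sum.distrib)
    qed
    have "0 \<le> quad_form m C y" for y
      using min[of y] unfolding C t_def by simp
    moreover have "quad_form m C z = 0" unfolding C by (simp add: z t_def)
    ultimately have "(\<Sum>j<m. C i j * z j) = 0" if "i < m" for i
      using that by (intro quad_form_null_vector) (auto simp: C_def sym)
    moreover have "\<exists>i<m. z i \<noteq> 0"
    proof (rule ccontr)
      assume "\<not> (\<exists>i<m. z i \<noteq> 0)"
      hence "(\<Sum>i<m. (z i)\<^sup>2) = 0" by simp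
      thus False using z by simp
    qed
    ultimately have "Determinant.det (Matrix.mat m m (\<lambda>(i, j). C i j)) = 0"
      unfolding det_mat_eq_0_iff by blast
    also have "Matrix.mat m m (\<lambda>(i, j). C i j) = principal_mat m C {..<m}"
      unfolding principal_mat_def by (intro cong_mat) auto
    finally have "Determinant.det (principal_mat m C {..<m}) = 0" .
    moreover have "t ^ m \<le> Determinant.det (principal_mat m C {..<m})"
      using det_shifted_principal_mat_ge[of m B t "{..<m}" "{..<m}"] minors t
      by (simp add: C_def)
    ultimately show False using zero_less_power[OF t, of m] by linarith
  qed
  hence "0 \<le> quad_form m B z * (\<Sum>i<m. (y i)\<^sup>2)" by (simp add: sum_nonneg)
  thus ?thesis using min[of y] by (rule order_trans)
qed (simp add: quad_form_def)

section \<open>Minors of a diagonal plus a Gram matrix, and underdetermined systems\<close>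

lemma det_mat_row_zero:
  fixes F :: "nat \<Rightarrow> nat \<Rightarrow> real"
  assumes "k < m"
  shows "Determinant.det (Matrix.mat m m (\<lambda>(i, j). if i = k then 0 else F i j)) = 0"
  using det_mat_row_add[OF assms, of "\<lambda>_. 0" 1 "\<lambda>_. 0" F]
  by (simp only: mult_1 add_0 mult_zero_right)

text \<open>Scaling out the diagonal leaves \<open>1 + X * Y\<close>, and exchanging the factors
  reduces the size from \<open>m\<close> to \<open>n\<close>. Outside \<open>J\<close> the diagonal
  entry is \<open>1\<close> and the row of \<open>X\<close> is zero, which produces the unit rows of
  \<open>principal_mat\<close>.\<close>

lemma det_principal_mat_diag_plus_gram:
  assumes J: "J \<subseteq> {..<m}" and d: "\<And>k. k \<in> J \<Longrightarrow> d k \<noteq> 0"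
  shows "Determinant.det (principal_mat m
      (\<lambda>i j. (if i = j then d i else 0) + (\<Sum>a<n. g i a * g j a)) J) =
    (\<Prod>k\<in>J. d k) * Determinant.det (Matrix.mat n n
      (\<lambda>(a, b). (if a = b then 1 else 0) + (\<Sum>k\<in>J. g k a * g k b / d k)))"
proof -
  let ?D = "Matrix.mat m m (\<lambda>(i, j). if i = j then if i \<in> J then d i else 1 else 0)"
  let ?X = "Matrix.mat m n (\<lambda>(i, a). if i \<in> J then g i a / d i else 0)"
  let ?Y = "Matrix.mat n m (\<lambda>(a, j). g j a)"
  have X: "?X \<in> carrier_mat m n" and Y: "?Y \<in> carrier_mat n m" and D: "?D \<in> carrier_mat m m"
    by auto
  have XY: "1\<^sub>m m + ?X * ?Y \<in> carrier_mat m m" by auto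
  have "principal_mat m (\<lambda>i j. (if i = j then d i else 0) + (\<Sum>a<n. g i a * g j a)) J =
      ?D * (1\<^sub>m m + ?X * ?Y)" (is "?P = _")
  proof (rule eq_matI)
    fix i j assume "i < dim_row (?D * (1\<^sub>m m + ?X * ?Y))" "j < dim_col (?D * (1\<^sub>m m + ?X * ?Y))"
    hence ij: "i < m" "j < m" by auto
    have XYij: "(?X * ?Y) $$ (l, j) = (if l \<in> J then (\<Sum>a<n. g l a * g j a) / d l else 0)"
      if "l < m" for l
      using that ij by (simp add: scalar_prod_def lessThan_atLeast0 sum_divide_distrib)
    have "(?D * (1\<^sub>m m + ?X * ?Y)) $$ (i, j) =
        (\<Sum>l<m. (if i = l then if i \<in> J then d i else 1 else 0) * (1\<^sub>m m + ?X * ?Y) $$ (l, j))"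
      using ij by (simp add: scalar_prod_def lessThan_atLeast0)
    also have "\<dots> = (if i \<in> J then d i else 1) * (1\<^sub>m m + ?X * ?Y) $$ (i, j)"
      using ij by (simp add: if_distrib[of "\<lambda>t. t * _"] cong: if_cong)
    also have "\<dots> = ?P $$ (i, j)"
      using ij XYij[OF ij(1)] d[of i] by (auto simp: principal_mat_def field_simps)
    finally show "?P $$ (i, j) = (?D * (1\<^sub>m m + ?X * ?Y)) $$ (i, j)" ..
  qed (simp_all add: principal_mat_def)
  hence "Determinant.det ?P = Determinant.det ?D * Determinant.det (1\<^sub>m m + ?X * ?Y)"
    using det_mult[OF D XY] by simp
  also have "Determinant.det (1\<^sub>m m + ?X * ?Y) = Determinant.det (1\<^sub>m n + ?Y * ?X)"
    by (rule det_one_plus_mult_commute[OF X Y])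
  also have "1\<^sub>m n + ?Y * ?X = Matrix.mat n n
      (\<lambda>(a, b). (if a = b then 1 else 0) + (\<Sum>k\<in>J. g k a * g k b / d k))"
  proof (rule eq_matI)
    fix a b assume "a < dim_row (Matrix.mat n n
      (\<lambda>(a, b). (if a = b then 1 else 0) + (\<Sum>k\<in>J. g k a * g k b / d k)))"
      "b < dim_col (Matrix.mat n n
      (\<lambda>(a, b). (if a = b then 1 else 0) + (\<Sum>k\<in>J. g k a * g k b / d k)))"
    hence ab: "a < n" "b < n" by auto
    have "(?Y * ?X) $$ (a, b) = (\<Sum>k<m. g k a * (if k \<in> J then g k b / d k else 0))"
      using ab by (simp add: scalar_prod_def lessThan_atLeast0)
    also have "\<dots> = (\<Sum>k\<in>J. g k a * g k b / d k)"
      using J by (intro sum.mono_neutral_cong_right) auto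
    finally show "(1\<^sub>m n + ?Y * ?X) $$ (a, b) = Matrix.mat n n
      (\<lambda>(a, b). (if a = b then 1 else 0) + (\<Sum>k\<in>J. g k a * g k b / d k)) $$ (a, b)"
      using ab by simp
  qed simp_all
  also have "Determinant.det ?D = (\<Prod>k\<in>J. d k)"
  proof -
    have "Determinant.det ?D = prod_list (diag_mat ?D)"
      by (rule det_upper_triangular[of _ m]) (auto intro!: upper_triangularI)
    also have "\<dots> = (\<Prod>i = 0..<m. if i \<in> J then d i else 1)"
      by (simp add: prod_list_diag_prod)
    also have "\<dots> = (\<Prod>k\<in>J. d k)"
      using J by (intro prod.mono_neutral_cong_right) auto
    finally show ?thesis .
  qed
  finally show ?thesis .
qed

lemma sum_atLeast1_eq_lessThan: "(\<Sum>k\<in>{1..m}. f k) = (\<Sum>i<m. f (Suc i))" for m :: nat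
  by (metis One_nat_def atLeastLessThanSuc_atLeastAtMost lessThan_atLeast0 sum.shift_bounds_Suc_ivl)

text \<open>These are \<open>n\<close> equations in the \<open>n + 1\<close> unknowns
  \<open>z 1, ..., z (n + 1)\<close>. A zero row appended to the coefficients gives a singular
  square matrix, whose kernel vector is the solution.\<close>

lemma homogeneous_system_nontrivial:
  fixes c :: "nat \<Rightarrow> nat \<Rightarrow> real"
  assumes "n < m"
  obtains z where "\<And>k. k \<notin> {1..n + 1} \<Longrightarrow> z k = 0" "\<exists>k\<in>{1..n + 1}. z k \<noteq> 0"
    "\<And>j. j \<in> {1..n} \<Longrightarrow> (\<Sum>k\<in>{1..m}. c j k * z k) = 0"
proof -
  let ?F = "\<lambda>i j. if i = n then 0 else c (Suc i) (Suc j)"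
  have "Determinant.det (Matrix.mat (Suc n) (Suc n) (\<lambda>(i, j). ?F i j)) = 0"
    by (rule det_mat_row_zero) simp
  then obtain y where y: "\<exists>i<Suc n. y i \<noteq> 0" "\<And>i. i < Suc n \<Longrightarrow> (\<Sum>j<Suc n. ?F i j * y j) = 0"
    unfolding det_mat_eq_0_iff by blast
  define z where "z k = (if k \<in> {1..n + 1} then y (k - 1) else 0)" for k
  show thesis
  proof (rule that)
    show "z k = 0" if "k \<notin> {1..n + 1}" for k using that by (auto simp: z_def)
    obtain i where "i < Suc n" "y i \<noteq> 0" using y(1) by blast
    thus "\<exists>k\<in>{1..n + 1}. z k \<noteq> 0" by (intro bexI[of _ "Suc i"]) (auto simp: z_def)
    fix j assume j: "j \<in> {1..n}"
    have "(\<Sum>k\<in>{1..m}. c j k * z k) = (\<Sum>k\<in>{1..Suc n}. c j k * z k)"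
      using assms by (intro sum.mono_neutral_right) (auto simp: z_def)
    also have "\<dots> = (\<Sum>i<Suc n. c j (Suc i) * y i)"
      unfolding sum_atLeast1_eq_lessThan by (intro sum.cong) (auto simp: z_def)
    also have "\<dots> = (\<Sum>i<Suc n. ?F (j - 1) i * y i)"
      using j by (intro sum.cong) auto
    also have "\<dots> = 0" using j by (intro y(2)) auto
    finally show "(\<Sum>k\<in>{1..m}. c j k * z k) = 0" .
  qed
qed

subsection \<open>The quadratic form of the approximation problem\<close>

text \<open>For \<open>w\<close> the coordinates of orthonormal \<open>x j\<close> in the left
  singular vectors, this is \<open>c\<^sup>2\<close> times the squared length of \<open>z\<close>
  minus the squared distance of the point with coordinates \<open>\<sigma> k * z k\<close> from the
  span of the \<open>x j\<close>.\<close>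

definition width_form ::
  "nat \<Rightarrow> nat \<Rightarrow> (nat \<Rightarrow> real) \<Rightarrow> (nat \<Rightarrow> nat \<Rightarrow> real) \<Rightarrow> real \<Rightarrow> (nat \<Rightarrow> real) \<Rightarrow> real" where
  "width_form m n \<sigma> w c z = (\<Sum>k\<in>{1..m}. (c\<^sup>2 - (\<sigma> k)\<^sup>2) * (z k)\<^sup>2) +
     (\<Sum>j\<in>{1..n}. (\<Sum>k\<in>{1..m}. w k j * \<sigma> k * z k)\<^sup>2)"

text \<open>The 0-based matrix of \<open>width_form\<close>, in the shape that
  \<open>det_principal_mat_diag_plus_gram\<close> expects.\<close>

definition width_mat ::
  "nat \<Rightarrow> (nat \<Rightarrow> real) \<Rightarrow> (nat \<Rightarrow> nat \<Rightarrow> real) \<Rightarrow> real \<Rightarrow> nat \<Rightarrow> nat \<Rightarrow> real" where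
  "width_mat n \<sigma> w c i j = (if i = j then c\<^sup>2 - (\<sigma> (Suc i))\<^sup>2 else 0) +
     (\<Sum>a<n. (w (Suc i) (Suc a) * \<sigma> (Suc i)) * (w (Suc j) (Suc a) * \<sigma> (Suc j)))"

lemma quad_form_width_mat:
  "quad_form m (width_mat n \<sigma> w c) z = width_form m n \<sigma> w c (\<lambda>k. z (k - 1))"
proof -
  let ?g = "\<lambda>i a. w (Suc i) (Suc a) * \<sigma> (Suc i)"
  have "z i * width_mat n \<sigma> w c i j * z j =
      (if i = j then (c\<^sup>2 - (\<sigma> (Suc i))\<^sup>2) * (z i)\<^sup>2 else 0) +
      (\<Sum>a<n. (?g i a * z i) * (?g j a * z j))" for i j
    by (simp add: width_mat_def distrib_left distrib_right sum_distrib_left sum_distrib_right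
        power2_eq_square mult_ac)
  hence "quad_form m (width_mat n \<sigma> w c) z =
      (\<Sum>i<m. \<Sum>j<m. if i = j then (c\<^sup>2 - (\<sigma> (Suc i))\<^sup>2) * (z i)\<^sup>2 else 0) +
      (\<Sum>i<m. \<Sum>j<m. \<Sum>a<n. (?g i a * z i) * (?g j a * z j))"
    unfolding quad_form_def by (simp only: sum.distrib)
  also have "(\<Sum>i<m. \<Sum>j<m. if i = j then (c\<^sup>2 - (\<sigma> (Suc i))\<^sup>2) * (z i)\<^sup>2 else 0) =
      (\<Sum>i<m. (c\<^sup>2 - (\<sigma> (Suc i))\<^sup>2) * (z i)\<^sup>2)"
    by simp
  also have "(\<Sum>i<m. \<Sum>j<m. \<Sum>a<n. (?g i a * z i) * (?g j a * z j)) =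
      (\<Sum>i<m. \<Sum>a<n. \<Sum>j<m. (?g i a * z i) * (?g j a * z j))"
    by (intro sum.cong refl sum.swap)
  also have "\<dots> = (\<Sum>a<n. \<Sum>i<m. \<Sum>j<m. (?g i a * z i) * (?g j a * z j))"
    by (rule sum.swap)
  also have "\<dots> = (\<Sum>a<n. (\<Sum>i<m. ?g i a * z i)\<^sup>2)"
    by (simp only: power2_eq_square sum_product)
  finally show ?thesis unfolding width_form_def sum_atLeast1_eq_lessThan by simp
qed

lemma sign_prod_card:
  fixes d :: "'a \<Rightarrow> real"
  assumes "finite J" and "\<And>k. k \<in> J \<inter> N \<Longrightarrow> d k < 0" and "\<And>k. k \<in> J - N \<Longrightarrow> 0 < d k"
  shows "\<exists>P>0. (\<Prod>k\<in>J. d k) = (-1) ^ card (N \<inter> J) * P"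
proof (intro exI conjI)
  show "0 < (\<Prod>k\<in>J. \<bar>d k\<bar>)"
    using assms by (intro prod_pos) (metis DiffI IntI abs_of_pos zero_less_abs_iff less_irrefl)
  have "(\<Prod>k\<in>J. d k) = (\<Prod>k\<in>J. (if k \<in> N then -1 else 1) * \<bar>d k\<bar>)"
    using assms(2,3) by (intro prod.cong) (auto simp: abs_of_neg abs_of_pos)
  also have "\<dots> = (\<Prod>k\<in>J. if k \<in> N then -1 else 1) * (\<Prod>k\<in>J. \<bar>d k\<bar>)"
    by (rule prod.distrib)
  also have "(\<Prod>k\<in>J. if k \<in> N then -1 else (1::real)) = (-1) ^ card (N \<inter> J)"
    using assms(1) by (simp add: prod.If_cases Int_commute)
  finally show "(\<Prod>k\<in>J. d k) = (-1) ^ card (N \<inter> J) * (\<Prod>k\<in>J. \<bar>d k\<bar>)" .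
qed

section \<open>Nonnegativity of the form in terms of the determinants of
  \<open>M_mat\<close>\<close>

context
  fixes m n :: nat and \<sigma> :: "nat \<Rightarrow> real" and w :: "nat \<Rightarrow> nat \<Rightarrow> real" and s :: real
  assumes n: "1 \<le> n" "n < m"
    and s: "\<sigma> (n + 1) = s" "0 < s"
    and large: "\<And>k. k \<in> {1..n} \<Longrightarrow> s < \<sigma> k"
    and small: "\<And>k. n + 2 \<le> k \<Longrightarrow> 0 \<le> \<sigma> k \<and> \<sigma> k < s"
    and gram: "\<And>i j. i \<in> {1..n} \<Longrightarrow> j \<in> {1..n} \<Longrightarrow>
      (\<Sum>k\<in>{1..m}. w k i * w k j) = (if i = j then 1 else 0)"
begin

lemma sq_large: "k \<in> {1..n} \<Longrightarrow> s\<^sup>2 < (\<sigma> k)\<^sup>2"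
  using large[of k] s by (intro power_strict_mono) auto

lemma sq_small: "n + 2 \<le> k \<Longrightarrow> (\<sigma> k)\<^sup>2 < s\<^sup>2"
  using small[of k] by (intro power_strict_mono) auto

text \<open>The index \<open>n + 1\<close> stays out of \<open>J\<close> because its diagonal entry
  \<open>s\<^sup>2 - (\<sigma> (n + 1))\<^sup>2\<close> is zero and cannot be divided by.
  Orthonormality then turns the small matrix into \<open>M_mat\<close>.\<close>

lemma det_principal_width_mat:
  assumes J: "J \<subseteq> {1..m} - {n + 1}"
  shows "Determinant.det (principal_mat m (width_mat n \<sigma> w s) {i. Suc i \<in> J}) =
    (\<Prod>k\<in>J. s\<^sup>2 - (\<sigma> k)\<^sup>2) * Determinant.det (M_mat m n \<sigma> w J)"
proof -
  let ?I = "{i. Suc i \<in> J}"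
  have d: "s\<^sup>2 - (\<sigma> k)\<^sup>2 \<noteq> 0" if "k \<in> J" for k
  proof -
    have "k \<in> {1..n} \<or> n + 2 \<le> k" using J that by auto
    thus ?thesis using sq_large[of k] sq_small[of k] by auto
  qed
  have I: "?I \<subseteq> {..<m}" using J by auto
  have bij: "bij_betw Suc ?I J"
  proof -
    have "k \<in> Suc ` ?I" if "k \<in> J" for k
      using that J by (intro image_eqI[of _ _ "k - 1"]) auto
    thus ?thesis by (auto simp: bij_betw_def)
  qed
  have finJ: "finite J" using J finite_subset by blast
  have "Determinant.det (principal_mat m (width_mat n \<sigma> w s) ?I) =
    (\<Prod>i\<in>?I. s\<^sup>2 - (\<sigma> (Suc i))\<^sup>2) * Determinant.det (Matrix.mat n n
      (\<lambda>(a, b). (if a = b then 1 else 0) + (\<Sum>i\<in>?I. (w (Suc i) (Suc a) * \<sigma> (Suc i)) *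
        (w (Suc i) (Suc b) * \<sigma> (Suc i)) / (s\<^sup>2 - (\<sigma> (Suc i))\<^sup>2))))"
    unfolding width_mat_def
    by (rule det_principal_mat_diag_plus_gram[OF I]) (use d in auto)
  also have "(\<Prod>i\<in>?I. s\<^sup>2 - (\<sigma> (Suc i))\<^sup>2) = (\<Prod>k\<in>J. s\<^sup>2 - (\<sigma> k)\<^sup>2)"
    by (rule prod.reindex_bij_betw[OF bij])
  also have "Matrix.mat n n
      (\<lambda>(a, b). (if a = b then 1 else 0) + (\<Sum>i\<in>?I. (w (Suc i) (Suc a) * \<sigma> (Suc i)) *
        (w (Suc i) (Suc b) * \<sigma> (Suc i)) / (s\<^sup>2 - (\<sigma> (Suc i))\<^sup>2))) = M_mat m n \<sigma> w J"
    unfolding M_mat_def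
  proof (intro cong_mat refl, unfold prod.case)
    fix a b assume ab: "a < n" "b < n"
    let ?w = "\<lambda>k. w k (a + 1) * w k (b + 1)"
    \<comment> \<open>The identity is the Gram matrix of the columns of \<open>w\<close>; its
      summands outside \<open>J\<close> already form the second sum of \<open>M_mat\<close>.\<close>
    have "(if a = b then 1 else 0) = (\<Sum>k\<in>{1..m}. ?w k)"
      using gram[of "a + 1" "b + 1"] ab by simp
    also have "\<dots> = (\<Sum>k\<in>J. ?w k) + (\<Sum>k\<in>{1..m} - J. ?w k)"
      using J by (subst sum.subset_diff[of J]) auto
    finally have delta: "(if a = b then 1 else 0) = (\<Sum>k\<in>J. ?w k) + (\<Sum>k\<in>{1..m} - J. ?w k)" .
    have "(\<Sum>i\<in>?I. (w (Suc i) (Suc a) * \<sigma> (Suc i)) *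
        (w (Suc i) (Suc b) * \<sigma> (Suc i)) / (s\<^sup>2 - (\<sigma> (Suc i))\<^sup>2)) =
        (\<Sum>k\<in>J. (w k (Suc a) * \<sigma> k) * (w k (Suc b) * \<sigma> k) / (s\<^sup>2 - (\<sigma> k)\<^sup>2))"
      by (rule sum.reindex_bij_betw[OF bij])
    \<comment> \<open>Termwise \<open>1 + (\<sigma> k)\<^sup>2 / (s\<^sup>2 - (\<sigma> k)\<^sup>2)
      = s\<^sup>2 / (s\<^sup>2 - (\<sigma> k)\<^sup>2)\<close>.\<close>
    moreover have "(\<Sum>k\<in>J. ?w k) +
        (\<Sum>k\<in>J. (w k (Suc a) * \<sigma> k) * (w k (Suc b) * \<sigma> k) / (s\<^sup>2 - (\<sigma> k)\<^sup>2)) =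
        s\<^sup>2 * (\<Sum>k\<in>J. ?w k / (s\<^sup>2 - (\<sigma> k)\<^sup>2))"
      unfolding sum.distrib[symmetric] sum_distrib_left
      using d by (intro sum.cong) (auto simp: field_simps power2_eq_square)
    ultimately show "(if a = b then 1 else 0) + (\<Sum>i\<in>?I. (w (Suc i) (Suc a) * \<sigma> (Suc i)) *
        (w (Suc i) (Suc b) * \<sigma> (Suc i)) / (s\<^sup>2 - (\<sigma> (Suc i))\<^sup>2)) =
        (\<sigma> (n + 1))\<^sup>2 * (\<Sum>k\<in>J. ?w k / ((\<sigma> (n + 1))\<^sup>2 - (\<sigma> k)\<^sup>2)) + (\<Sum>k\<in>{1..m} - J. ?w k)"
      unfolding delta s(1) by linarith
  qed
  finally show ?thesis .
qed

lemma principal_minor_sign: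
  assumes J: "J \<subseteq> {1..m} - {n + 1}"
  shows "0 \<le> Determinant.det (principal_mat m (width_mat n \<sigma> w s) {i. Suc i \<in> J}) \<longleftrightarrow>
    0 \<le> (-1) ^ card ({1..n} \<inter> J) * Determinant.det (M_mat m n \<sigma> w J)"
proof -
  have "\<exists>P>0. (\<Prod>k\<in>J. s\<^sup>2 - (\<sigma> k)\<^sup>2) = (-1) ^ card ({1..n} \<inter> J) * P"
  proof (rule sign_prod_card)
    show "finite J" using J finite_subset by blast
    show "s\<^sup>2 - (\<sigma> k)\<^sup>2 < 0" if "k \<in> J \<inter> {1..n}" for k
      using that sq_large[of k] by simp
    fix k assume "k \<in> J - {1..n}"
    hence "n + 2 \<le> k" using J by auto
    thus "0 < s\<^sup>2 - (\<sigma> k)\<^sup>2" using sq_small by simp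
  qed
  then obtain P where P: "P > 0" "(\<Prod>k\<in>J. s\<^sup>2 - (\<sigma> k)\<^sup>2) = (-1) ^ card ({1..n} \<inter> J) * P" by blast
  have "Determinant.det (principal_mat m (width_mat n \<sigma> w s) {i. Suc i \<in> J}) =
      P * ((-1) ^ card ({1..n} \<inter> J) * Determinant.det (M_mat m n \<sigma> w J))"
    unfolding det_principal_width_mat[OF J] P(2) by simp
  thus ?thesis using P(1) by (simp only: zero_le_mult_iff) auto
qed

lemma width_form_nonneg_imp_perp:
  assumes "\<And>z. 0 \<le> width_form m n \<sigma> w s z" and j: "j \<in> {1..n}"
  shows "w (n + 1) j = 0"
proof -
  obtain z where z: "\<And>k. k \<notin> {1..n + 1} \<Longrightarrow> z k = 0" "\<exists>k\<in>{1..n + 1}. z k \<noteq> 0"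
    "\<And>j. j \<in> {1..n} \<Longrightarrow> (\<Sum>k\<in>{1..m}. w k j * \<sigma> k * z k) = 0"
    by (rule homogeneous_system_nontrivial[OF n(2), of "\<lambda>j k. w k j * \<sigma> k"]) blast
  \<comment> \<open>On the support of \<open>z\<close> no diagonal coefficient is positive, and the
    squares in the second sum of the form vanish by the choice of \<open>z\<close>. Nonnegativity
    therefore makes every diagonal term zero.\<close>
  have nonpos: "(s\<^sup>2 - (\<sigma> k)\<^sup>2) * (z k)\<^sup>2 \<le> 0" for k
    using z(1)[of k] sq_large[of k] s by (cases "k \<in> {1..n}"; cases "k = n + 1")
      (auto simp: mult_nonpos_nonneg)
  have "width_form m n \<sigma> w s z = (\<Sum>k\<in>{1..m}. (s\<^sup>2 - (\<sigma> k)\<^sup>2) * (z k)\<^sup>2)"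
    unfolding width_form_def using z(3) by simp
  hence "0 \<le> (\<Sum>k\<in>{1..m}. (s\<^sup>2 - (\<sigma> k)\<^sup>2) * (z k)\<^sup>2)" using assms(1) by metis
  hence "(\<Sum>k\<in>{1..m}. (s\<^sup>2 - (\<sigma> k)\<^sup>2) * (z k)\<^sup>2) = 0"
    using sum_nonpos[of "{1..m}" "\<lambda>k. (s\<^sup>2 - (\<sigma> k)\<^sup>2) * (z k)\<^sup>2"] nonpos by (simp add: antisym)
  hence zero: "(s\<^sup>2 - (\<sigma> k)\<^sup>2) * (z k)\<^sup>2 = 0" if "k \<in> {1..m}" for k
    using that nonpos sum_nonneg_eq_0_iff[of "{1..m}" "\<lambda>k. - ((s\<^sup>2 - (\<sigma> k)\<^sup>2) * (z k)\<^sup>2)"]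
    by (simp only: sum_negf neg_0_le_iff_le neg_equal_0_iff_equal finite_atLeastAtMost) blast
  have zn: "z k = 0" if "k \<in> {1..n}" for k
    using zero[of k] that sq_large[OF that] n(2) by auto
  hence zk: "z k = 0" if "k \<noteq> n + 1" for k
    using that z(1)[of k] by (cases "k \<in> {1..n}") auto
  have "z (n + 1) \<noteq> 0"
  proof
    assume "z (n + 1) = 0"
    hence "z k = 0" for k using zk by (cases "k = n + 1") auto
    thus False using z(2) by simp
  qed
  \<comment> \<open>The strict gap has removed the first \<open>n\<close> coordinates of
    \<open>z\<close>, so one summand of equation \<open>j\<close> survives;
    \<open>\<sigma> (n + 1)\<close> and \<open>z (n + 1)\<close> are both nonzero.\<close>
  moreover have "(\<Sum>k\<in>{1..m}. w k j * \<sigma> k * z k) = w (n + 1) j * \<sigma> (n + 1) * z (n + 1)"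
    using n(2) zk by (subst sum.remove[of _ "n + 1"]) (auto intro!: sum.neutral)
  ultimately show ?thesis using z(3)[OF j] s by simp
qed

theorem width_form_nonneg_iff:
  "(\<forall>z. 0 \<le> width_form m n \<sigma> w s z) \<longleftrightarrow>
    (\<forall>j\<in>{1..n}. w (n + 1) j = 0) \<and>
    (\<forall>J. J \<subseteq> {1..m} - {n + 1} \<and> {1..n} \<inter> J \<noteq> {} \<longrightarrow>
       (-1) ^ card ({1..n} \<inter> J) * Determinant.det (M_mat m n \<sigma> w J) \<ge> 0)"
  (is "?L \<longleftrightarrow> ?perp \<and> ?minors")
proof (intro iffI conjI)
  assume L: ?L
  show ?perp using width_form_nonneg_imp_perp L by blast
  show ?minors
  proof (intro allI impI)
    fix J assume J: "J \<subseteq> {1..m} - {n + 1} \<and> {1..n} \<inter> J \<noteq> {}"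
    have "0 \<le> Determinant.det (principal_mat m (width_mat n \<sigma> w s) {i. Suc i \<in> J})"
      by (rule principal_minor_nonneg) (use L in \<open>simp add: quad_form_width_mat\<close>)
    thus "(-1) ^ card ({1..n} \<inter> J) * Determinant.det (M_mat m n \<sigma> w J) \<ge> 0"
      using principal_minor_sign J by blast
  qed
next
  assume R: "?perp \<and> ?minors"
  \<comment> \<open>Matrix index \<open>n\<close> belongs to row \<open>n + 1\<close> of
    \<open>w\<close>. Index sets containing it, and those avoiding \<open>{..<n}\<close>, are not
    covered by \<open>?minors\<close> and are treated separately.\<close>
  have minors: "0 \<le> Determinant.det (principal_mat m (width_mat n \<sigma> w s) I)" if I: "I \<subseteq> {..<m}" for I
  proof (cases "I \<inter> {..<n} = {} \<or> n \<in> I")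
    case True
    show ?thesis
    proof (cases "n \<in> I")
      case False
      \<comment> \<open>Here \<open>I\<close> lies beyond \<open>n\<close>, where the diagonal
        coefficients are positive, and the rest of the form is a sum of squares. Hence the form is
        nonnegative on vectors supported on \<open>I\<close>, which is all that
        \<open>principal_minor_nonneg\<close> asks for.\<close>
      show ?thesis
      proof (rule principal_minor_nonneg)
        fix z :: "nat \<Rightarrow> real" assume z: "\<And>i. i < m \<Longrightarrow> i \<notin> I \<Longrightarrow> z i = 0"
        have "0 \<le> (s\<^sup>2 - (\<sigma> k)\<^sup>2) * (z (k - 1))\<^sup>2" if k: "k \<in> {1..m}" for k
        proof (cases "n + 2 \<le> k")
          case True
          thus ?thesis using sq_small[of k] by (intro mult_nonneg_nonneg) auto
        next
          case 2: False
          hence "k - 1 \<notin> I" using False True k by (cases "k - 1 = n") auto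
          hence "z (k - 1) = 0" using z[of "k - 1"] k by auto
          thus ?thesis by simp
        qed
        thus "0 \<le> quad_form m (width_mat n \<sigma> w s) z"
          unfolding quad_form_width_mat width_form_def
          by (intro add_nonneg_nonneg sum_nonneg) auto
      qed
    next
      case True
      \<comment> \<open>Orthogonality removes the Gram part of row \<open>n\<close>, and its
        diagonal entry is \<open>s\<^sup>2 - s\<^sup>2\<close>, so the minor has a zero row.\<close>
      have "width_mat n \<sigma> w s n j = 0" for j
        using R s(1) by (auto simp: width_mat_def)
      hence "\<exists>F. principal_mat m (width_mat n \<sigma> w s) I =
          Matrix.mat m m (\<lambda>(i, j). if i = n then 0 else F i j)"
        using True unfolding principal_mat_def
        by (intro exI[of _ "\<lambda>i j. if i \<in> I then width_mat n \<sigma> w s i j else if i = j then 1 else 0"]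
            cong_mat) auto
      then obtain F where F: "principal_mat m (width_mat n \<sigma> w s) I =
          Matrix.mat m m (\<lambda>(i, j). if i = n then 0 else F i j)" ..
      show ?thesis unfolding F
        by (simp add: det_mat_row_zero[OF n(2)])
    qed
  next
    case False
    let ?J = "Suc ` I"
    have J: "?J \<subseteq> {1..m} - {n + 1}" using I False by auto
    obtain i where "i \<in> I" "i < n" using False by auto
    hence "Suc i \<in> {1..n} \<inter> ?J" by auto
    hence "{1..n} \<inter> ?J \<noteq> {}" by blast
    moreover have "{i. Suc i \<in> ?J} = I" by auto
    ultimately show ?thesis using principal_minor_sign[OF J] J R by metis
  qed
  show ?L
  proof
    fix z
    have "0 \<le> quad_form m (width_mat n \<sigma> w s) (\<lambda>i. z (Suc i))"
      by (rule quad_form_nonneg_if_minors_nonneg[OF _ minors])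
         (auto simp: width_mat_def mult.commute)
    also have "\<dots> = width_form m n \<sigma> w s z"
      unfolding quad_form_width_mat width_form_def by (intro arg_cong2[of _ _ _ _ "(+)"] sum.cong
         arg_cong[of _ _ "\<lambda>t. t\<^sup>2"]) auto
    finally show "0 \<le> width_form m n \<sigma> w s z" .
  qed
qed

end

subsection \<open>Approximation error and singular values\<close>

lemma norm_sq_orthonormal_sum:
  fixes u :: "nat \<Rightarrow> 'a::real_inner"
  assumes "\<And>i j. i \<in> I \<Longrightarrow> j \<in> I \<Longrightarrow> u i \<bullet> u j = (if i = j then 1 else 0)" "finite I"
  shows "(norm (\<Sum>k\<in>I. c k *\<^sub>R u k))\<^sup>2 = (\<Sum>k\<in>I. (c k)\<^sup>2)"
proof -
  have "(\<Sum>k\<in>I. c k *\<^sub>R u k) \<bullet> (\<Sum>k\<in>I. c k *\<^sub>R u k) =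
      (\<Sum>k\<in>I. \<Sum>l\<in>I. c k * (c l * (u k \<bullet> u l)))"
    by (simp add: inner_sum_left inner_sum_right sum_distrib_left inner_commute mult.left_commute)
  also have "\<dots> = (\<Sum>k\<in>I. \<Sum>l\<in>I. if k = l then c k * c l else 0)"
    using assms(1) by (intro sum.cong) auto
  also have "\<dots> = (\<Sum>k\<in>I. (c k)\<^sup>2)"
    using assms(2) by (simp add: power2_eq_square)
  finally show ?thesis by (simp add: power2_norm_eq_inner)
qed

lemma inner_orthonormal_sum:
  fixes u :: "nat \<Rightarrow> 'a::real_inner"
  assumes "\<And>i j. i \<in> I \<Longrightarrow> j \<in> I \<Longrightarrow> u i \<bullet> u j = (if i = j then 1 else 0)" "finite I" "j \<in> I"
  shows "u j \<bullet> (\<Sum>k\<in>I. c k *\<^sub>R u k) = c j"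
proof -
  have "u j \<bullet> (\<Sum>k\<in>I. c k *\<^sub>R u k) = (\<Sum>k\<in>I. if j = k then c k else 0)"
    unfolding inner_sum_right using assms by (intro sum.cong) auto
  thus ?thesis using assms(2,3) by simp
qed

text \<open>The infimum is attained at the orthogonal projection \<open>p\<close>, by Pythagoras for
  \<open>a - y = (a - p) + (p - y)\<close>. Pythagoras for \<open>a = (a - p) + p\<close> gives its
  value.\<close>

lemma INF_norm_diff_span_orthonormal:
  fixes x :: "nat \<Rightarrow> 'a::euclidean_space"
  assumes x: "\<And>i j. i \<in> I \<Longrightarrow> j \<in> I \<Longrightarrow> x i \<bullet> x j = (if i = j then 1 else 0)" and I: "finite I"
  shows "(INF y\<in>span (x ` I). norm (a - y)) = sqrt ((norm a)\<^sup>2 - (\<Sum>j\<in>I. (x j \<bullet> a)\<^sup>2))"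
proof -
  define p where "p = (\<Sum>j\<in>I. (x j \<bullet> a) *\<^sub>R x j)"
  have p: "p \<in> span (x ` I)" unfolding p_def by (intro span_sum span_mul span_base imageI)
  have orth_x: "Linear_Algebra.orthogonal (a - p) (x j)" if "j \<in> I" for j
    unfolding Linear_Algebra.orthogonal_def p_def
    using inner_orthonormal_sum[OF x I that, of "\<lambda>j. x j \<bullet> a"]
    by (simp add: inner_diff_left inner_diff_right inner_commute)
  have orth: "Linear_Algebra.orthogonal (a - p) y" if "y \<in> span (x ` I)" for y
    by (rule orthogonal_to_span[OF that]) (use orth_x in blast)
  have "norm (a - p) \<le> norm (a - y)" if y: "y \<in> span (x ` I)" for y
  proof -
    have "(norm ((a - p) + (p - y)))\<^sup>2 = (norm (a - p))\<^sup>2 + (norm (p - y))\<^sup>2"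
      by (rule norm_add_Pythagorean) (rule orth[OF span_diff[OF p y]])
    hence "(norm (a - p))\<^sup>2 \<le> (norm (a - y))\<^sup>2" by simp
    thus ?thesis by (simp add: power2_le_iff_abs_le)
  qed
  hence "(INF y\<in>span (x ` I). norm (a - y)) = norm (a - p)"
    using p by (intro cInf_eq_minimum) auto
  moreover have "(norm ((a - p) + p))\<^sup>2 = (norm (a - p))\<^sup>2 + (norm p)\<^sup>2"
    by (rule norm_add_Pythagorean) (rule orth[OF p])
  moreover have "(norm p)\<^sup>2 = (\<Sum>j\<in>I. (x j \<bullet> a)\<^sup>2)"
    unfolding p_def by (rule norm_sq_orthonormal_sum[OF x I])
  ultimately have "(INF y\<in>span (x ` I). norm (a - y)) = norm (a - p)"
    and "(norm a)\<^sup>2 - (\<Sum>j\<in>I. (x j \<bullet> a)\<^sup>2) = (norm (a - p))\<^sup>2" by simp_all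
  thus ?thesis by simp
qed

lemma approx_error_le_iff:
  fixes K X :: "'a::euclidean_space set"
  assumes "compact K" "K \<noteq> {}" "subspace X"
  shows "approx_error K X \<le> c \<longleftrightarrow> (\<forall>a\<in>K. (INF x\<in>X. norm (a - x)) \<le> c)"
  using approx_error_max[OF assms] by (metis order_trans)

lemma approx_error_nonneg:
  fixes K X :: "'a::euclidean_space set"
  assumes "compact K" "K \<noteq> {}" "subspace X"
  shows "0 \<le> approx_error K X"
proof -
  obtain a where "approx_error K X = (INF x\<in>X. norm (a - x))"
    using approx_error_max[OF assms] by blast
  moreover obtain x where "norm (a - x) = (INF x\<in>X. norm (a - x))"
    using approx_error_min[OF assms(3)] by blast
  ultimately show ?thesis by (metis norm_ge_zero)
qed

text \<open>A basis indexed from 1 makes the coordinate criterion available for an arbitrary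
  subspace, as the lower bound on the width requires.\<close>

lemma subspace_orthonormal_family:
  fixes X :: "'a::euclidean_space set"
  assumes "subspace X"
  obtains x :: "nat \<Rightarrow> 'a" where
    "\<And>i j. i \<in> {1..dim X} \<Longrightarrow> j \<in> {1..dim X} \<Longrightarrow> x i \<bullet> x j = (if i = j then 1 else 0)"
    "span (x ` {1..dim X}) = X"
proof -
  obtain B where B: "pairwise Linear_Algebra.orthogonal B" "\<And>b. b \<in> B \<Longrightarrow> norm b = 1"
    "independent B" "card B = dim X" "span B = X"
    using orthonormal_basis_subspace[OF assms] by metis
  have "finite B" using B(3) by (rule independent_imp_finite)
  then obtain x where x: "bij_betw x {1..dim X} B"
    using ex_bij_betw_nat_finite_1 B(4) by metis
  show thesis
  proof (rule that[of x])
    show "span (x ` {1..dim X}) = X" using x B(5) by (simp add: bij_betw_def)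
    fix i j assume ij: "i \<in> {1..dim X}" "j \<in> {1..dim X}"
    hence mem: "x i \<in> B" "x j \<in> B" using x by (auto simp: bij_betw_def)
    show "x i \<bullet> x j = (if i = j then 1 else 0)"
    proof (cases "i = j")
      case True
      thus ?thesis using B(2)[OF mem(1)] by (simp add: dot_square_norm)
    next
      case False
      hence "x i \<noteq> x j" using x ij by (auto simp: bij_betw_def inj_on_def)
      thus ?thesis using B(1) mem False by (auto simp: pairwise_def Linear_Algebra.orthogonal_def)
    qed
  qed
qed

lemma dim_span_orthonormal:
  fixes x :: "nat \<Rightarrow> 'a::euclidean_space"
  assumes x: "\<And>i j. i \<in> I \<Longrightarrow> j \<in> I \<Longrightarrow> x i \<bullet> x j = (if i = j then 1 else 0)" and I: "finite I"
  shows "dim (span (x ` I)) = card I"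
proof -
  have inj: "inj_on x I"
  proof (rule inj_onI)
    fix i j assume "i \<in> I" "j \<in> I" "x i = x j"
    thus "i = j" using x[of i i] x[of i j] by (auto split: if_splits)
  qed
  have "pairwise Linear_Algebra.orthogonal (x ` I)"
    using x by (auto simp: pairwise_def Linear_Algebra.orthogonal_def)
  moreover have "0 \<notin> x ` I" using x by fastforce
  ultimately have "independent (x ` I)" by (rule pairwise_orthogonal_independent)
  thus ?thesis using card_image[OF inj] by (simp add: dim_eq_card_independent)
qed

lemma orthonormal_columns:
  fixes U :: "real^'m::finite^'m"
  assumes "orthogonal_matrix U" "bij_betw e {1..m} UNIV" "i \<in> {1..m}" "j \<in> {1..m}"
  shows "column (e i) U \<bullet> column (e j) U = (if i = j then 1 else 0)"
proof (cases "i = j")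
  case True
  moreover have "norm (column (e j) U) = 1"
    using assms(1) by (simp add: orthogonal_matrix_orthonormal_columns)
  ultimately show ?thesis by (simp add: dot_square_norm)
next
  case False
  hence "e i \<noteq> e j" using assms(2-4) by (auto simp: bij_betw_def inj_on_def)
  thus ?thesis using assms(1) False by (simp add: orthogonal_matrix_orthonormal_columns Linear_Algebra.orthogonal_def)
qed

lemma matrix_mult_columns:
  fixes U :: "real^'m::finite^'m"
  assumes "bij_betw e {1..m} UNIV"
  shows "U *v q = (\<Sum>k\<in>{1..m}. q $ e k *\<^sub>R column (e k) U)"
proof -
  have "U *v q = (\<Sum>i\<in>UNIV. q $ i *\<^sub>R column i U)"
    by (simp add: matrix_mult_sum scalar_mult_eq_scaleR)
  thus ?thesis using sum.reindex_bij_betw[OF assms, of "\<lambda>i. q $ i *\<^sub>R column i U"] by simp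
qed

lemma transpose_mult_component: "(Finite_Cartesian_Product.transpose U *v y) $ i = column i U \<bullet> y"
  for U :: "real^'m::finite^'m"
  by (simp add: matrix_vector_mult_def Finite_Cartesian_Product.transpose_def column_def inner_vec_def)

lemma orthogonal_matrix_expansion:
  fixes U :: "real^'m::finite^'m"
  assumes "orthogonal_matrix U" "bij_betw e {1..m} UNIV"
  shows "y = (\<Sum>k\<in>{1..m}. (column (e k) U \<bullet> y) *\<^sub>R column (e k) U)"
proof -
  have "y = U *v (Finite_Cartesian_Product.transpose U *v y)"
    using assms(1)
    by (simp add: orthogonal_matrix_def matrix_vector_mul_assoc del: transpose_matrix_vector)
  also have "\<dots> = (\<Sum>k\<in>{1..m}. (column (e k) U \<bullet> y) *\<^sub>R column (e k) U)"
    unfolding matrix_mult_columns[OF assms(2), of U] transpose_mult_component ..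
  finally show ?thesis .
qed

section \<open>The n-width of the ellipsoid in singular coordinates\<close>

context
  fixes A U S V :: "real^'m::finite^'m" and e :: "nat \<Rightarrow> 'm" and m :: nat and \<sigma> :: "nat \<Rightarrow> real"
    and u :: "nat \<Rightarrow> real^'m"
  assumes svd: "is_svd e A U S V"
  defines "m \<equiv> CARD('m)" and "\<sigma> \<equiv> sing_val e S" and "u \<equiv> left_sing_vec e U"
begin

lemma svd_bij: "bij_betw e {1..m} UNIV"
  using svd unfolding is_svd_def m_def by blast

lemma svd_orthogonal: "orthogonal_matrix U"
  using svd unfolding is_svd_def by blast

lemma left_orthonormal: "i \<in> {1..m} \<Longrightarrow> j \<in> {1..m} \<Longrightarrow> u i \<bullet> u j = (if i = j then 1 else 0)"
  unfolding u_def left_sing_vec_def by (rule orthonormal_columns[OF svd_orthogonal svd_bij])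

lemma left_expansion: "y = (\<Sum>k\<in>{1..m}. (u k \<bullet> y) *\<^sub>R u k)"
  unfolding u_def left_sing_vec_def by (rule orthogonal_matrix_expansion[OF svd_orthogonal svd_bij])

lemma svd_apply: "A *v y = (\<Sum>k\<in>{1..m}. (\<sigma> k * (column (e k) V \<bullet> y)) *\<^sub>R u k)"
proof -
  have off: "S $ i $ j = 0" if "i \<noteq> j" for i j
    using svd that unfolding is_svd_def by blast
  have diag: "(S *v q) $ i = S $ i $ i * q $ i" for q i
  proof -
    have "(S *v q) $ i = (\<Sum>j\<in>UNIV. S $ i $ j * q $ j)"
      by (simp add: matrix_vector_mult_def)
    also have "\<dots> = (\<Sum>j\<in>UNIV. if i = j then S $ i $ i * q $ i else 0)"
      by (rule sum.cong) (use off in auto)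
    finally show ?thesis by simp
  qed
  have "A *v y = U *v (S *v (Finite_Cartesian_Product.transpose V *v y))"
    using svd unfolding is_svd_def by (simp only: matrix_vector_mul_assoc matrix_mul_assoc)
  also have "\<dots> = (\<Sum>k\<in>{1..m}. (S $ e k $ e k * (column (e k) V \<bullet> y)) *\<^sub>R u k)"
    unfolding matrix_mult_columns[OF svd_bij, of U] diag transpose_mult_component
      u_def left_sing_vec_def ..
  also have "\<dots> = (\<Sum>k\<in>{1..m}. (\<sigma> k * (column (e k) V \<bullet> y)) *\<^sub>R u k)"
    by (intro sum.cong) (auto simp: \<sigma>_def sing_val_def m_def)
  finally show ?thesis .
qed

text \<open>\<open>V\<close> is orthogonal, so as \<open>y\<close> runs through the unit ball, its
  coefficients in the columns of \<open>V\<close> run through all \<open>z\<close> with sum of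
  squares at most one.\<close>

lemma ball_image_eq:
  "ball_image A = {\<Sum>k\<in>{1..m}. (\<sigma> k * z k) *\<^sub>R u k | z. (\<Sum>k\<in>{1..m}. (z k)\<^sup>2) \<le> 1}"
proof -
  let ?v = "\<lambda>k. column (e k) V"
  have V: "orthogonal_matrix V" using svd by (simp add: is_svd_def)
  note orth = orthonormal_columns[OF V svd_bij]
  show ?thesis
  proof (intro equalityI subsetI)
    fix a assume "a \<in> ball_image A"
    then obtain y where y: "a = A *v y" "norm y \<le> 1" unfolding ball_image_def by blast
    have "(norm y)\<^sup>2 = (\<Sum>k\<in>{1..m}. (?v k \<bullet> y)\<^sup>2)"
      using norm_sq_orthonormal_sum[of "{1..m}" ?v "\<lambda>k. ?v k \<bullet> y"] orth
        orthogonal_matrix_expansion[OF V svd_bij, of y] by simp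
    moreover have "(norm y)\<^sup>2 \<le> 1" using y(2) by (simp add: power_le_one)
    ultimately show "a \<in> {\<Sum>k\<in>{1..m}. (\<sigma> k * z k) *\<^sub>R u k | z. (\<Sum>k\<in>{1..m}. (z k)\<^sup>2) \<le> 1}"
      unfolding y(1) svd_apply by (intro CollectI exI[of _ "\<lambda>k. ?v k \<bullet> y"]) simp
  next
    fix a assume "a \<in> {\<Sum>k\<in>{1..m}. (\<sigma> k * z k) *\<^sub>R u k | z. (\<Sum>k\<in>{1..m}. (z k)\<^sup>2) \<le> 1}"
    then obtain z where z: "a = (\<Sum>k\<in>{1..m}. (\<sigma> k * z k) *\<^sub>R u k)" "(\<Sum>k\<in>{1..m}. (z k)\<^sup>2) \<le> 1"
      by blast
    define y where "y = (\<Sum>k\<in>{1..m}. z k *\<^sub>R ?v k)"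
    have "?v k \<bullet> y = z k" if "k \<in> {1..m}" for k
      unfolding y_def by (rule inner_orthonormal_sum) (use orth that in auto)
    hence "A *v y = a" unfolding svd_apply z(1) by (intro sum.cong) auto
    moreover have "(norm y)\<^sup>2 = (\<Sum>k\<in>{1..m}. (z k)\<^sup>2)"
      unfolding y_def by (rule norm_sq_orthonormal_sum) (use orth in auto)
    hence "norm y \<le> 1" using z(2) abs_square_le_1[of "norm y"] by simp
    ultimately show "a \<in> ball_image A" unfolding ball_image_def by blast
  qed
qed

text \<open>By the projection formula \<open>G z\<close> is the squared distance of the point
  \<open>a z\<close> from the span, and the form is \<open>c\<^sup>2\<close> times the sum of
  squares of \<open>z\<close> minus \<open>G z\<close>.\<close>

lemma approx_error_le_iff_width_form:
  fixes x :: "nat \<Rightarrow> real^'m"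
  assumes x: "\<And>i j. i \<in> {1..n} \<Longrightarrow> j \<in> {1..n} \<Longrightarrow> x i \<bullet> x j = (if i = j then 1 else 0)"
    and c: "0 \<le> c"
  shows "approx_error (ball_image A) (span (x ` {1..n})) \<le> c \<longleftrightarrow>
    (\<forall>z. 0 \<le> width_form m n \<sigma> (\<lambda>k j. u k \<bullet> x j) c z)"
proof -
  define G where "G z = (\<Sum>k\<in>{1..m}. (\<sigma> k * z k)\<^sup>2) -
    (\<Sum>j\<in>{1..n}. (\<Sum>k\<in>{1..m}. (u k \<bullet> x j) * \<sigma> k * z k)\<^sup>2)" for z
  have form: "width_form m n \<sigma> (\<lambda>k j. u k \<bullet> x j) c z = c\<^sup>2 * (\<Sum>k\<in>{1..m}. (z k)\<^sup>2) - G z" for z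
    unfolding width_form_def G_def
    by (simp add: left_diff_distrib sum_subtractf sum_distrib_left power_mult_distrib)
  define a where "a z = (\<Sum>k\<in>{1..m}. (\<sigma> k * z k) *\<^sub>R u k)" for z
  have dist: "(INF y\<in>span (x ` {1..n}). norm (a z - y)) = sqrt (G z)" for z
  proof -
    have "x j \<bullet> a z = (\<Sum>k\<in>{1..m}. (u k \<bullet> x j) * \<sigma> k * z k)" for j
      unfolding a_def by (simp add: inner_sum_right inner_commute mult_ac)
    moreover have "(norm (a z))\<^sup>2 = (\<Sum>k\<in>{1..m}. (\<sigma> k * z k)\<^sup>2)"
      unfolding a_def by (rule norm_sq_orthonormal_sum[OF left_orthonormal finite_atLeastAtMost])
    ultimately show ?thesis
      using INF_norm_diff_span_orthonormal[OF x finite_atLeastAtMost, where a = "a z"]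
      unfolding G_def by simp
  qed
  have sqrt_le: "sqrt (G z) \<le> c \<longleftrightarrow> G z \<le> c\<^sup>2" for z
    using c by (auto intro: sqrt_le_D real_le_lsqrt)
  have "approx_error (ball_image A) (span (x ` {1..n})) \<le> c \<longleftrightarrow>
      (\<forall>b\<in>ball_image A. (INF y\<in>span (x ` {1..n}). norm (b - y)) \<le> c)"
    by (rule approx_error_le_iff[OF compact_ball_image ball_image_nonempty subspace_span])
  also have "\<dots> \<longleftrightarrow> (\<forall>z. (\<Sum>k\<in>{1..m}. (z k)\<^sup>2) \<le> 1 \<longrightarrow>
      (INF y\<in>span (x ` {1..n}). norm (a z - y)) \<le> c)"
    unfolding ball_image_eq a_def by blast
  also have "\<dots> \<longleftrightarrow> (\<forall>z. (\<Sum>k\<in>{1..m}. (z k)\<^sup>2) \<le> 1 \<longrightarrow> G z \<le> c\<^sup>2)"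
    unfolding dist sqrt_le ..
  \<comment> \<open>\<open>G\<close> is homogeneous of degree two, so the bound on the unit ball
    extends to all \<open>z\<close> by scaling; the case \<open>q = 0\<close> cannot be scaled, but
    there \<open>G z\<close> vanishes.\<close>
  also have "\<dots> \<longleftrightarrow> (\<forall>z. G z \<le> c\<^sup>2 * (\<Sum>k\<in>{1..m}. (z k)\<^sup>2))" (is "?L \<longleftrightarrow> ?R")
  proof
    assume ?R
    show ?L
    proof (intro allI impI)
      fix z :: "nat \<Rightarrow> real" assume "(\<Sum>k\<in>{1..m}. (z k)\<^sup>2) \<le> 1"
      hence "c\<^sup>2 * (\<Sum>k\<in>{1..m}. (z k)\<^sup>2) \<le> c\<^sup>2 * 1" by (intro mult_left_mono) auto
      thus "G z \<le> c\<^sup>2" using \<open>?R\<close>[rule_format, of z] by simp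
    qed
  next
    assume ?L
    show ?R
    proof
      fix z :: "nat \<Rightarrow> real"
      define q where "q = (\<Sum>k\<in>{1..m}. (z k)\<^sup>2)"
      show "G z \<le> c\<^sup>2 * (\<Sum>k\<in>{1..m}. (z k)\<^sup>2)"
      proof (cases "q = 0")
        case True
        hence "z k = 0" if "k \<in> {1..m}" for k
          using that by (simp add: q_def sum_nonneg_eq_0_iff)
        hence "G z = 0" by (simp add: G_def)
        thus ?thesis by (simp add: sum_nonneg)
      next
        case False
        hence q: "0 < q" unfolding q_def by (simp add: sum_nonneg less_le)
        have "(\<Sum>k\<in>{1..m}. (z k / sqrt q)\<^sup>2) = 1"
          using q by (simp add: power_divide q_def flip: sum_divide_distrib)
        hence "G (\<lambda>k. z k / sqrt q) \<le> c\<^sup>2" using \<open>?L\<close> by simp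
        moreover have "G (\<lambda>k. z k / sqrt q) = G z / q"
          using q by (simp add: G_def power_divide diff_divide_distrib flip: sum_divide_distrib)
        ultimately show ?thesis using q by (simp add: field_simps q_def)
      qed
    qed
  qed
  also have "\<dots> \<longleftrightarrow> (\<forall>z. 0 \<le> width_form m n \<sigma> (\<lambda>k j. u k \<bullet> x j) c z)"
    unfolding form by simp
  finally show ?thesis .
qed

lemma sing_val_nonneg: "0 \<le> \<sigma> k"
  using svd unfolding is_svd_def \<sigma>_def sing_val_def by auto

lemma sing_val_antimono:
  assumes "1 \<le> k" "k \<le> l"
  shows "\<sigma> l \<le> \<sigma> k"
proof -
  have step: "\<sigma> (Suc k) \<le> \<sigma> k" if "1 \<le> k" for k
  proof (cases "k < m")
    case True
    thus ?thesis using svd that unfolding is_svd_def \<sigma>_def sing_val_def m_def by auto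
  next
    case False
    \<comment> \<open>From \<open>m + 1\<close> on, the default value \<open>0\<close> of
      \<open>sing_val\<close> continues the sequence monotonically.\<close>
    hence "\<sigma> (Suc k) = 0" by (simp add: \<sigma>_def sing_val_def m_def)
    thus ?thesis using sing_val_nonneg by simp
  qed
  show ?thesis using assms(2)
  proof (induction l rule: dec_induct)
    case (step l)
    thus ?case using \<open>\<And>k. 1 \<le> k \<Longrightarrow> \<sigma> (Suc k) \<le> \<sigma> k\<close>[of l] assms(1) by simp
  qed simp
qed

text \<open>The lower bound is a dimension count as in the Courant-Fischer principle: if the error
  \<open>c\<close> were below \<open>\<sigma> (n + 1)\<close>, a nonzero \<open>z\<close> on the
  first \<open>n + 1\<close> coordinates would annul the second sum of the form and make the form
  negative. The span of the first \<open>n\<close> left singular vectors attains the bound.\<close>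

lemma n_width_ball_image:
  assumes n: "n < m"
  shows "n_width n (ball_image A) = \<sigma> (n + 1)"
    and "subspace X \<Longrightarrow> dim X = n \<Longrightarrow> \<sigma> (n + 1) \<le> approx_error (ball_image A) X"
proof -
  have lower: "\<sigma> (n + 1) \<le> approx_error (ball_image A) X" if X: "subspace X" "dim X = n" for X
  proof (rule ccontr)
    define c where "c = approx_error (ball_image A) X"
    assume "\<not> \<sigma> (n + 1) \<le> approx_error (ball_image A) X"
    hence less: "c < \<sigma> (n + 1)" by (simp add: c_def)
    have c: "0 \<le> c" unfolding c_def
      by (rule approx_error_nonneg[OF compact_ball_image ball_image_nonempty X(1)])
    obtain x :: "nat \<Rightarrow> real^'m"
      where x: "\<And>i j. i \<in> {1..n} \<Longrightarrow> j \<in> {1..n} \<Longrightarrow> x i \<bullet> x j = (if i = j then 1 else 0)"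
      "span (x ` {1..n}) = X"
      by (rule subspace_orthonormal_family[OF X(1)]) (use X(2) in auto)
    let ?w = "\<lambda>k j. u k \<bullet> x j"
    have nonneg: "0 \<le> width_form m n \<sigma> ?w c z" for z
      using approx_error_le_iff_width_form[OF x(1) c, of n] x(2) unfolding c_def by blast
    obtain z where z: "\<And>k. k \<notin> {1..n + 1} \<Longrightarrow> z k = 0" "\<exists>k\<in>{1..n + 1}. z k \<noteq> 0"
      "\<And>j. j \<in> {1..n} \<Longrightarrow> (\<Sum>k\<in>{1..m}. ?w k j * \<sigma> k * z k) = 0"
      by (rule homogeneous_system_nontrivial[OF n, of "\<lambda>j k. ?w k j * \<sigma> k"]) blast
    have sq: "c\<^sup>2 < (\<sigma> k)\<^sup>2" if "k \<in> {1..n + 1}" for k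
      using sing_val_antimono[of k "n + 1"] that less c by (intro power_strict_mono) auto
    have "width_form m n \<sigma> ?w c z = (\<Sum>k\<in>{1..m}. (c\<^sup>2 - (\<sigma> k)\<^sup>2) * (z k)\<^sup>2)"
      unfolding width_form_def using z(3) by simp
    also have "\<dots> = - (\<Sum>k\<in>{1..m}. ((\<sigma> k)\<^sup>2 - c\<^sup>2) * (z k)\<^sup>2)"
      by (simp flip: sum_negf add: algebra_simps)
    also have "\<dots> < 0"
    proof -
      obtain k where k: "k \<in> {1..n + 1}" "z k \<noteq> 0" using z(2) by blast
      have "0 < (\<Sum>k\<in>{1..m}. ((\<sigma> k)\<^sup>2 - c\<^sup>2) * (z k)\<^sup>2)"
      proof (rule sum_pos2[of _ k])
        show "k \<in> {1..m}" using k n by auto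
        show "0 < ((\<sigma> k)\<^sup>2 - c\<^sup>2) * (z k)\<^sup>2" using sq[OF k(1)] k(2) by simp
        fix l show "0 \<le> ((\<sigma> l)\<^sup>2 - c\<^sup>2) * (z l)\<^sup>2"
          using sq[of l] z(1)[of l] by (cases "l \<in> {1..n + 1}") auto
      qed simp
      thus ?thesis by simp
    qed
    finally show False using nonneg[of z] by simp
  qed
  thus "subspace X \<Longrightarrow> dim X = n \<Longrightarrow> \<sigma> (n + 1) \<le> approx_error (ball_image A) X" .
  let ?X = "span (u ` {1..n})"
  have u: "u i \<bullet> u j = (if i = j then 1 else 0)" if "i \<in> {1..n}" "j \<in> {1..n}" for i j
    using left_orthonormal[of i j] that n by auto
  have "0 \<le> width_form m n \<sigma> (\<lambda>k j. u k \<bullet> u j) (\<sigma> (n + 1)) z" for z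
  proof -
    \<comment> \<open>The coordinates of the left singular vectors are Kronecker deltas, so one
      summand remains.\<close>
    have "(\<Sum>k\<in>{1..m}. (u k \<bullet> u j) * \<sigma> k * z k) = \<sigma> j * z j" if "j \<in> {1..n}" for j
    proof -
      have "(\<Sum>k\<in>{1..m}. (u k \<bullet> u j) * \<sigma> k * z k) = (\<Sum>k\<in>{1..m}. if k = j then \<sigma> k * z k else 0)"
        using left_orthonormal[of _ j] that n by (intro sum.cong) auto
      thus ?thesis using that n by simp
    qed
    hence "width_form m n \<sigma> (\<lambda>k j. u k \<bullet> u j) (\<sigma> (n + 1)) z =
        (\<Sum>k\<in>{1..m}. ((\<sigma> (n + 1))\<^sup>2 - (\<sigma> k)\<^sup>2) * (z k)\<^sup>2) + (\<Sum>k\<in>{1..n}. (\<sigma> k * z k)\<^sup>2)"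
      unfolding width_form_def by simp
    \<comment> \<open>Padding with zeros allows a termwise comparison: for \<open>k \<le> n\<close>
      the added square cancels the negative part, and beyond \<open>n\<close> the coefficient is
      nonnegative by monotonicity.\<close>
    also have "(\<Sum>k\<in>{1..n}. (\<sigma> k * z k)\<^sup>2) = (\<Sum>k\<in>{1..m}. if k \<le> n then (\<sigma> k * z k)\<^sup>2 else 0)"
      using n by (intro sum.mono_neutral_cong_left) auto
    also have "(\<Sum>k\<in>{1..m}. ((\<sigma> (n + 1))\<^sup>2 - (\<sigma> k)\<^sup>2) * (z k)\<^sup>2) + \<dots> \<ge> 0"
      unfolding sum.distrib[symmetric]
    proof (rule sum_nonneg)
      fix k assume k: "k \<in> {1..m}"
      show "0 \<le> ((\<sigma> (n + 1))\<^sup>2 - (\<sigma> k)\<^sup>2) * (z k)\<^sup>2 + (if k \<le> n then (\<sigma> k * z k)\<^sup>2 else 0)"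
      proof (cases "k \<le> n")
        case True
        thus ?thesis by (simp add: algebra_simps power_mult_distrib)
      next
        case False
        hence "(\<sigma> k)\<^sup>2 \<le> (\<sigma> (n + 1))\<^sup>2"
          using sing_val_antimono[of "n + 1" k] sing_val_nonneg by (intro power_mono) auto
        thus ?thesis using False by simp
      qed
    qed
    finally show ?thesis .
  qed
  hence "approx_error (ball_image A) ?X \<le> \<sigma> (n + 1)"
    using approx_error_le_iff_width_form[OF u sing_val_nonneg] by blast
  moreover have X: "dim ?X = n" "subspace ?X"
    using dim_span_orthonormal[OF u finite_atLeastAtMost] by auto
  ultimately have eq: "approx_error (ball_image A) ?X = \<sigma> (n + 1)"
    using lower by (metis order_antisym)
  show "n_width n (ball_image A) = \<sigma> (n + 1)"
    unfolding n_width_def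
  proof (rule cInf_eq_minimum)
    show "\<sigma> (n + 1) \<in> approx_error (ball_image A) ` {X. subspace X \<and> dim X = n}"
      using eq X by (intro image_eqI[of _ _ ?X]) auto
  qed (use lower in auto)
qed

text \<open>No \<open>n\<close>-dimensional subspace has an error below the width, so optimality
  amounts to the inequality \<open>\<le>\<close> alone.\<close>

lemma optimal_subspace_iff_width_form:
  fixes x :: "nat \<Rightarrow> real^'m"
  assumes n: "n < m"
    and x: "\<And>i j. i \<in> {1..n} \<Longrightarrow> j \<in> {1..n} \<Longrightarrow> x i \<bullet> x j = (if i = j then 1 else 0)"
  shows "optimal_subspace n (ball_image A) (span (x ` {1..n})) \<longleftrightarrow>
    (\<forall>z. 0 \<le> width_form m n \<sigma> (\<lambda>k j. u k \<bullet> x j) (\<sigma> (n + 1)) z)"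
proof -
  have X: "dim (span (x ` {1..n})) = n" "subspace (span (x ` {1..n}))"
    using dim_span_orthonormal[OF x finite_atLeastAtMost] by auto
  have "optimal_subspace n (ball_image A) (span (x ` {1..n})) \<longleftrightarrow>
      approx_error (ball_image A) (span (x ` {1..n})) \<le> \<sigma> (n + 1)"
    unfolding optimal_subspace_def n_width_ball_image(1)[OF n]
    using X n_width_ball_image(2)[OF n X(2,1)] by auto
  also have "\<dots> \<longleftrightarrow> (\<forall>z. 0 \<le> width_form m n \<sigma> (\<lambda>k j. u k \<bullet> x j) (\<sigma> (n + 1)) z)"
    by (rule approx_error_le_iff_width_form[OF x sing_val_nonneg])
  finally show ?thesis .
qed

end

section \<open>The determinant criterion for optimal subspaces\<close>

theorem theorem5:
  fixes A U S V :: "real^'m::finite^'m"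
    and e :: "nat \<Rightarrow> 'm"
    and n :: nat
    and x :: "nat \<Rightarrow> real^'m"
    and w :: "nat \<Rightarrow> nat \<Rightarrow> real"
  assumes svd: "is_svd e A U S V"
    and n: "1 \<le> n" "n \<le> CARD('m) - 1"
    and gap: "sing_val e S n > sing_val e S (n + 1)"
      "sing_val e S (n + 1) > sing_val e S (n + 2)"
      "sing_val e S (n + 2) \<ge> 0"
    and orthonormal: "\<forall>i\<in>{1..n}. \<forall>j\<in>{1..n}. x i \<bullet> x j = (if i = j then 1 else 0)"
    and coords: "\<forall>j\<in>{1..n}. x j = (\<Sum>i\<in>{1..CARD('m)}. w i j *\<^sub>R left_sing_vec e U i)"
  shows "optimal_subspace n (ball_image A) (span (x ` {1..n})) \<longleftrightarrow>
    (\<forall>y\<in>span (x ` {1..n}). Linear_Algebra.orthogonal y (left_sing_vec e U (n + 1))) \<and>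
    (\<forall>J. J \<subseteq> {1..CARD('m)} - {n + 1} \<and> {1..n} \<inter> J \<noteq> {} \<longrightarrow>
       (-1) ^ card ({1..n} \<inter> J) *
         Determinant.det (M_mat (CARD('m)) n (sing_val e S) w J) \<ge> 0)"
proof -
  let ?m = "CARD('m)" and ?\<sigma> = "sing_val e S" and ?u = "left_sing_vec e U"
  have nm: "n < ?m" using n zero_less_card_finite[where 'a = 'm] by linarith
  have x: "x i \<bullet> x j = (if i = j then 1 else 0)" if "i \<in> {1..n}" "j \<in> {1..n}" for i j
    using orthonormal that by blast
  have w: "?u k \<bullet> x j = w k j" if "k \<in> {1..?m}" "j \<in> {1..n}" for k j
    using inner_orthonormal_sum[OF left_orthonormal[OF svd] finite_atLeastAtMost that(1)]
      coords that(2) by simp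
  \<comment> \<open>Outside the index ranges \<open>w\<close> is arbitrary, but the form reads only
    entries inside them, where they are inner products.\<close>
  have form: "width_form ?m n ?\<sigma> (\<lambda>k j. ?u k \<bullet> x j) c = width_form ?m n ?\<sigma> w c" for c
    unfolding width_form_def using w by (intro ext) simp
  have gram: "(\<Sum>k\<in>{1..?m}. w k i * w k j) = (if i = j then 1 else 0)"
    if "i \<in> {1..n}" "j \<in> {1..n}" for i j
  proof -
    have "x i \<bullet> x j = (\<Sum>k\<in>{1..?m}. w k i *\<^sub>R ?u k) \<bullet> x j" using coords that by simp
    also have "\<dots> = (\<Sum>k\<in>{1..?m}. w k i * w k j)" using w that by (simp add: inner_sum_left)
    finally show ?thesis using x[OF that] by simp
  qed
  have perp: "(\<forall>y\<in>span (x ` {1..n}). Linear_Algebra.orthogonal y (?u (n + 1))) \<longleftrightarrow>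
      (\<forall>j\<in>{1..n}. w (n + 1) j = 0)"
  proof -
    \<comment> \<open>Orthogonality to a span is tested on the generators, where it reads
      \<open>w (n + 1) j = 0\<close>.\<close>
    have "(\<forall>y\<in>span (x ` {1..n}). Linear_Algebra.orthogonal y (?u (n + 1))) \<longleftrightarrow>
        (\<forall>j\<in>{1..n}. Linear_Algebra.orthogonal (?u (n + 1)) (x j))"
      using orthogonal_to_span[of _ "x ` {1..n}" "?u (n + 1)"]
      by (auto simp: orthogonal_commute intro: span_base)
    thus ?thesis using w[of "n + 1"] nm by (simp add: Linear_Algebra.orthogonal_def)
  qed
  have large: "?\<sigma> (n + 1) < ?\<sigma> k" if "k \<in> {1..n}" for k
    using sing_val_antimono[OF svd, of k n] that gap(1) by auto
  \<comment> \<open>Indices beyond \<open>?m\<close> are included: there \<open>sing_val\<close> is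
    \<open>0\<close>, and monotonicity from \<open>n + 2\<close> on still applies.\<close>
  have small: "0 \<le> ?\<sigma> k \<and> ?\<sigma> k < ?\<sigma> (n + 1)" if "n + 2 \<le> k" for k
    using sing_val_antimono[OF svd, of "n + 2" k] sing_val_nonneg[OF svd, of k] that gap(2) by auto
  have pos: "0 < ?\<sigma> (n + 1)" using gap by linarith
  have "optimal_subspace n (ball_image A) (span (x ` {1..n})) \<longleftrightarrow>
      (\<forall>z. 0 \<le> width_form ?m n ?\<sigma> w (?\<sigma> (n + 1)) z)"
    using optimal_subspace_iff_width_form[OF svd nm x] unfolding form .
  also note width_form_nonneg_iff[where \<sigma> = ?\<sigma> and w = w, OF n(1) nm refl pos large small gram]
  finally show ?thesis unfolding perp .
qed

end
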